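(* Let $p$ be a prime, $r\ge1$, $q=p^{2r}$, $s\ge1$, and $d$ a positive integer with $d\mid p^r+1$. Let $X$ be the projective hypersurface in $\mathbb{P}^s$ defined by $x_0^d+x_1^d+\cdots+x_s^d=0$, and let $N'_{k,s}$ be the number of its points in $\mathbb{P}^s(\mathbb{F}_{q^k})$. Then its zeta function $Z_s(t)=\exp\big(\sum_{k\ge1}N'_{k,s}t^k/k\big)$ is \[ Z_s(t)=\begin{cases}\dfrac{(1+q^{(s-1)/2}t)^{B(d,s+1)}}{\prod_{i=0}^{s-1}(1-q^it)}, & s\text{ even},\\[2ex] \dfrac{1}{(1-q^{(s-1)/2}t)^{B(d,s+1)}\prod_{i=0}^{s-1}(1-q^it)}, & s\text{ odd},\end{cases} \] where $B(d,m)=\frac1d\big((d-1)^m+(-1)^m(d-1)\big)$. Equivalently, $N'_{k,s}=\frac{q^{ks}-1}{q^k-1}+(-1)^{(k+1)(s+1)}q^{k(s-1)/2}B(d,s+1)$ for all $k\ge1$.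
   Context: $\mathbb{P}^s(\mathbb{F}_{q^k})$ denotes the set of nonzero $(s+1)$-tuples over $\mathbb{F}_{q^k}$ modulo nonzero scalar multiples. *)

theory Defs
  imports "HOL-Algebra.Ring" "HOL-Computational_Algebra.Formal_Power_Series"
begin

definition nonzero_tuples :: "('a, 'b) ring_scheme \<Rightarrow> nat \<Rightarrow> 'a list set" where
  "nonzero_tuples F s = {v. length v = s + 1 \<and> set v \<subseteq> carrier F \<and> (\<exists>x\<in>set v. x \<noteq> \<zero>\<^bsub>F\<^esub>)}"

definition proj_rel :: "('a, 'b) ring_scheme \<Rightarrow> nat \<Rightarrow> ('a list \<times> 'a list) set" where
  "proj_rel F s = {(u, v). u \<in> nonzero_tuples F s \<and> v \<in> nonzero_tuples F s \<and>
      (\<exists>c\<in>carrier F - {\<zero>\<^bsub>F\<^esub>}. u = map (\<lambda>x. c \<otimes>\<^bsub>F\<^esub> x) v)}"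

definition proj_space :: "('a, 'b) ring_scheme \<Rightarrow> nat \<Rightarrow> 'a list set set" where
  "proj_space F s = nonzero_tuples F s // proj_rel F s"

definition fermat_count :: "('a, 'b) ring_scheme \<Rightarrow> nat \<Rightarrow> nat \<Rightarrow> nat" where
  "fermat_count F d s = card {P \<in> proj_space F s.
      \<forall>v\<in>P. finsum F (\<lambda>i. v ! i [^]\<^bsub>F\<^esub> d) {..s} = \<zero>\<^bsub>F\<^esub>}"

text \<open>B(d,m) = ((d-1)^m + (-1)^m (d-1)) / d (an integer, nonnegative for d >= 1).\<close>
definition B :: "nat \<Rightarrow> nat \<Rightarrow> nat" where
  "B d m = nat ((((int d - 1) ^ m) + (-1) ^ m * (int d - 1)) div int d)"

definition zeta_fps :: "(nat \<Rightarrow> nat) \<Rightarrow> real fps" where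
  "zeta_fps N = fps_compose (fps_exp 1) (Abs_fps (\<lambda>k. if k = 0 then 0 else real (N k) / real k))"

end

theory Submission
  imports Defs "HOL-Algebra.Multiplicative_Group" Complex_Main
begin

text \<open>
  Let \<open>P = p\<^sup>r\<close>, so that \<open>d\<close> divides \<open>P + 1\<close> and the field has \<open>P\<^sup>2\<^sup>k\<close> elements. Everything is read off from
  the exponential sums \<open>S\<^sub>d(t) = \<Sum>x. \<psi>(t x\<^sup>d)\<close>, where \<open>\<psi>\<close> is the additive character given by the
  absolute trace: by orthogonality, the number of affine zeros is determined by the sum of
  \<open>S\<^sub>d(t)\<^sup>s\<^sup>+\<^sup>1\<close> over all \<open>t\<close>.

  For \<open>d = P + 1\<close> and \<open>t \<noteq> 0\<close>, the map \<open>x \<mapsto> t x\<^sup>P\<^sup>+\<^sup>1\<close> is a quadratic form as far as \<open>\<psi>\<close> is concerned, with a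
  radical of \<open>1\<close> or \<open>P\<^sup>2\<close> elements, so that \<open>|S(t)|\<^sup>2\<close> is \<open>0\<close>, \<open>P\<^sup>2\<^sup>k\<close> or \<open>P\<^sup>2\<^sup>k\<^sup>+\<^sup>2\<close>. Moreover \<open>S(t)\<close> is an integer
  congruent to \<open>1\<close> modulo \<open>P + 1\<close>, which leaves only the values \<open>(-P)\<^sup>k\<close> and \<open>(-P)\<^sup>k\<^sup>+\<^sup>1\<close>.
  As the sum over all \<open>t \<noteq> 0\<close> vanishes, the second value is attained on exactly one coset of the \<open>(P+1)\<close>-st powers. Averaging gives
  \<open>S\<^sub>d(t) \<in> {v, (1 - d) v}\<close> with \<open>v = (-P)\<^sup>k\<close>, the second value being attained for one \<open>t\<close> in \<open>d\<close>.
\<close>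

subsection \<open>Finite fields\<close>

text \<open>Sorts the indices by residue modulo \<open>b\<close>. With indices as exponents of a
  generator, this splits a sum over a cyclic group into sums over cosets of a subgroup.\<close>

lemma sum_lessThan_mult:
  fixes f :: "nat \<Rightarrow> 'c :: comm_monoid_add"
  shows "(\<Sum>i<a * b. f i) = (\<Sum>j<b. \<Sum>m<a. f (j + m * b))"
proof -
  have "(\<Sum>i<a * b. f i) = (\<Sum>m<a. \<Sum>i = m * b..<m * b + b. f i)"
    by (rule sum.nat_group[symmetric])
  also have "\<dots> = (\<Sum>m<a. \<Sum>j<b. f (j + m * b))"
  proof (rule sum.cong[OF refl])
    fix m
    show "(\<Sum>i = m * b..<m * b + b. f i) = (\<Sum>j<b. f (j + m * b))"
      using sum.shift_bounds_nat_ivl[of f 0 "m * b" b] by (simp add: add.commute atLeast0LessThan)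
  qed
  also have "\<dots> = (\<Sum>j<b. \<Sum>m<a. f (j + m * b))" by (rule sum.swap)
  finally show ?thesis .
qed

lemma sum_lessThan_periodic:
  fixes f :: "nat \<Rightarrow> 'c :: comm_semiring_1"
  assumes "\<And>i. f (i + b) = f i"
  shows "(\<Sum>i<a * b. f i) = of_nat a * (\<Sum>i<b. f i)"
proof -
  have "f (i + m * b) = f i" for i m
  proof (induction m)
    case (Suc m)
    then show ?case using assms[of "i + m * b"] by (simp add: algebra_simps)
  qed simp
  then show ?thesis by (simp add: sum_lessThan_mult sum_distrib_left)
qed

lemma (in abelian_monoid) finsum_swap:
  assumes "finite I" "finite J" "\<And>i j. i \<in> I \<Longrightarrow> j \<in> J \<Longrightarrow> f i j \<in> carrier G"
  shows "(\<Oplus>i\<in>I. \<Oplus>j\<in>J. f i j) = (\<Oplus>j\<in>J. \<Oplus>i\<in>I. f i j)"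
  using assms(1,3)
proof (induction I rule: finite_induct)
  case empty
  then show ?case by simp
next
  case (insert a I)
  have "(\<Oplus>j\<in>J. \<Oplus>i\<in>insert a I. f i j) = (\<Oplus>j\<in>J. f a j \<oplus> (\<Oplus>i\<in>I. f i j))"
    by (rule finsum_cong') (use insert in \<open>auto intro!: finsum_closed finsum_insert\<close>)
  also have "\<dots> = (\<Oplus>j\<in>J. f a j) \<oplus> (\<Oplus>j\<in>J. \<Oplus>i\<in>I. f i j)"
    by (rule finsum_addf) (use insert in \<open>auto intro!: finsum_closed\<close>)
  finally show ?case
    using insert by (subst finsum_insert) (auto intro!: finsum_closed)
qed

lemma pred_dvd_power_pred: "x \<ge> 1 \<Longrightarrow> (x - 1 :: nat) dvd x ^ m - 1"
proof (induction m)
  case (Suc m)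
  have "x ^ Suc m - 1 = x * (x ^ m - 1) + (x - 1)"
    using Suc.prems by (simp add: algebra_simps)
  then show ?case using Suc.IH[OF Suc.prems] by (metis dvd_add dvd_mult dvd_refl)
qed simp

lemma (in cring) binomial_theorem:
  assumes a: "a \<in> carrier R" and b: "b \<in> carrier R"
  shows "(a \<oplus> b) [^] (n::nat) = (\<Oplus>k\<in>{..n}. [(n choose k)] \<cdot> (a [^] k \<otimes> b [^] (n - k)))"
proof (induction n)
  case 0
  then show ?case using a b by simp
next
  case (Suc n)
  define T where "T n k = [(n choose k)] \<cdot> (a [^] k \<otimes> b [^] (n - k))" for n k :: nat
  have T[simp]: "T n k \<in> carrier R" for n k
    using a b by (simp add: T_def)
  have Tpi[simp]: "f \<in> A \<rightarrow> carrier R" if "\<And>k. f k \<in> carrier R" for f :: "nat \<Rightarrow> 'a" and A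
    using that by auto
  have sT: "finsum R (T n) {..n} \<in> carrier R" by (rule finsum_closed) simp
  have A1: "finsum R (T n) {..n} \<otimes> b = (\<Oplus>k\<in>{..n}. T n k \<otimes> b)"
    by (rule finsum_ldistr) (use b in auto)
  have A2: "finsum R (T n) {..n} \<otimes> a = (\<Oplus>k\<in>{..n}. T n k \<otimes> a)"
    by (rule finsum_ldistr) (use a in auto)
  \<comment> \<open>For \<open>k \<le> n\<close> this is \<open>T n k\<close> times
    \<open>b\<close>. Written this way it also makes sense at \<open>k = Suc n\<close>, where the
    binomial coefficient vanishes, so Pascal's rule in \<open>B2\<close> covers every
    \<open>k\<close>.\<close>
  define U where "U k = [(n choose k)] \<cdot> (a [^] k \<otimes> b [^] (Suc n - k))" for k
  have U[simp]: "U k \<in> carrier R" for k using a b by (simp add: U_def)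
  have B1: "T n k \<otimes> b = U k" if "k \<le> n" for k
    using that a b by (simp add: T_def U_def Suc_diff_le add_pow_ldistr m_assoc)
  have B2: "T (Suc n) (Suc k) = T n k \<otimes> a \<oplus> U (Suc k)" for k
  proof -
    have "T n k \<otimes> a = [(n choose k)] \<cdot> (a [^] (Suc k) \<otimes> b [^] (n - k))"
      using a b by (simp add: T_def add_pow_ldistr) (simp add: m_ac)
    then show ?thesis using a b by (simp add: T_def U_def add.nat_pow_mult [symmetric])
  qed
  have B3: "T (Suc n) 0 = U 0" by (simp add: T_def U_def)
  have U0: "U (Suc n) = \<zero>" by (simp add: U_def binomial_eq_0)
  have "finsum R (T (Suc n)) {..Suc n} = (\<Oplus>k\<in>{..n}. T (Suc n) (Suc k)) \<oplus> T (Suc n) 0"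
    by (rule finsum_Suc2) simp
  also have "(\<Oplus>k\<in>{..n}. T (Suc n) (Suc k)) = (\<Oplus>k\<in>{..n}. T n k \<otimes> a) \<oplus> (\<Oplus>k\<in>{..n}. U (Suc k))"
    unfolding B2 by (rule finsum_addf) (use a in auto)
  also have "\<dots> \<oplus> T (Suc n) 0 = (\<Oplus>k\<in>{..n}. T n k \<otimes> a) \<oplus> ((\<Oplus>k\<in>{..n}. U (Suc k)) \<oplus> U 0)"
    unfolding B3 by (rule a_assoc) (use a in \<open>auto intro!: finsum_closed\<close>)
  also have "(\<Oplus>k\<in>{..n}. U (Suc k)) \<oplus> U 0 = finsum R U {..Suc n}"
    by (rule finsum_Suc2 [symmetric]) simp
  also have "\<dots> = finsum R U {..n}"
    by (subst finsum_Suc) (auto simp: U0 finsum_closed)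
  also have "\<dots> = (\<Oplus>k\<in>{..n}. T n k \<otimes> b)"
    by (rule finsum_cong') (use B1 b in auto)
  also have "(\<Oplus>k\<in>{..n}. T n k \<otimes> a) \<oplus> (\<Oplus>k\<in>{..n}. T n k \<otimes> b) = finsum R (T n) {..n} \<otimes> (a \<oplus> b)"
    using sT a b by (simp add: A1 A2 r_distr)
  also have "finsum R (T n) {..n} = (a \<oplus> b) [^] n"
    unfolding Suc T_def ..
  finally show ?case unfolding T_def by simp
qed

section \<open>Cyclic multiplicative group, characteristic and Frobenius\<close>

locale finite_field = field R for R (structure) +
  fixes p n :: nat
  assumes finite_carrier [simp]: "finite (carrier R)"
    and prime_p: "prime p"
    and n_pos: "n > 0"
    and card_carrier: "card (carrier R) = p ^ n"
begin

definition N :: nat where "N = p ^ n - 1"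

lemma p_ge_2: "p \<ge> 2" using prime_p prime_ge_2_nat by auto

lemma q_ge_2: "p ^ n \<ge> 2"
  using p_ge_2 n_pos by (metis One_nat_def Suc_leI order_trans self_le_power le_trans one_le_numeral)

lemma N_pos: "N > 0" using q_ge_2 by (simp add: N_def)

lemma Suc_N: "Suc N = p ^ n" using q_ge_2 by (simp add: N_def)

lemma card_nonzero: "card (carrier R - {\<zero>}) = N"
  using card_carrier by (simp add: card_Diff_singleton N_def)

lemma pow_neq_zero: "x \<in> carrier R \<Longrightarrow> x \<noteq> \<zero> \<Longrightarrow> x [^] (i::nat) \<noteq> \<zero>"
  by (induction i) (use integral in auto)

lemma pow_N: "x \<in> carrier R \<Longrightarrow> x \<noteq> \<zero> \<Longrightarrow> x [^] N = \<one>"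
proof -
  assume x: "x \<in> carrier R" "x \<noteq> \<zero>"
  interpret G: group "mult_of R" rewrites
      "([^]\<^bsub>mult_of R\<^esub>) = (([^]) :: _ \<Rightarrow> nat \<Rightarrow> _)" and "\<one>\<^bsub>mult_of R\<^esub> = \<one>"
    by (rule field_mult_group) (simp_all add: fun_eq_iff nat_pow_def)
  show ?thesis using G.pow_order_eq_1[of x] x card_nonzero by (simp add: order_def)
qed

definition gen :: 'a where
  "gen = (SOME a. a \<in> carrier (mult_of R) \<and> carrier (mult_of R) = {a[^]i | i::nat . i \<in> UNIV})"

lemma gen: "gen \<in> carrier (mult_of R) \<and> carrier (mult_of R) = {gen[^]i | i::nat . i \<in> UNIV}"
  unfolding gen_def by (rule someI_ex) (use finite_field_mult_group_has_gen in auto)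

lemma gen_closed [simp]: "gen \<in> carrier R" and gen_nonzero [simp]: "gen \<noteq> \<zero>"
  using gen by auto

lemma gen_pow_nonzero [simp]: "gen [^] (i::nat) \<noteq> \<zero>"
  by (simp add: pow_neq_zero)

lemma gen_pow_mod: "gen [^] (i mod N) = gen [^] i"
proof -
  have "gen [^] i = gen [^] (i mod N + N * (i div N))" by simp
  also have "\<dots> = gen [^] (i mod N)"
    by (simp only: nat_pow_mult[symmetric] gen_closed nat_pow_pow[symmetric]) (simp add: pow_N)
  finally show ?thesis ..
qed

lemma nonzero_eq_gen_pow:
  assumes "x \<in> carrier R" "x \<noteq> \<zero>"
  obtains i :: nat where "i < N" "x = gen [^] i"
proof -
  obtain j :: nat where "x = gen [^] j" using gen assms by auto
  then show ?thesis using that[of "j mod N"] N_pos by (simp add: gen_pow_mod)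
qed

lemma bij_gen_pow: "bij_betw (\<lambda>i::nat. gen [^] i) {..<N} (carrier R - {\<zero>})"
proof -
  have im: "(\<lambda>i::nat. gen [^] i) ` {..<N} = carrier R - {\<zero>}"
    by (auto elim!: nonzero_eq_gen_pow)
  moreover have "inj_on (\<lambda>i::nat. gen [^] i) {..<N}"
    by (rule eq_card_imp_inj_on) (simp_all add: im card_nonzero)
  ultimately show ?thesis by (simp add: bij_betw_def)
qed

lemma gen_pow_eq_one_iff: "gen [^] i = \<one> \<longleftrightarrow> N dvd i"
proof -
  have "gen [^] i = \<one> \<longleftrightarrow> gen [^] (i mod N) = gen [^] (0::nat)" by (simp only: gen_pow_mod) simp
  also have "\<dots> \<longleftrightarrow> i mod N = 0"
    using bij_gen_pow N_pos by (auto simp: bij_betw_def inj_on_def)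
  finally show ?thesis by auto
qed

lemma sum_nonzero: "sum f (carrier R - {\<zero>}) = (\<Sum>i<N. f (gen [^] i))"
  by (rule sum.reindex_bij_betw[OF bij_gen_pow, symmetric])

lemma sum_carrier: "sum f (carrier R) = f \<zero> + (\<Sum>i<N. f (gen [^] i))"
  for f :: "'a \<Rightarrow> 'c :: comm_monoid_add"
  by (simp add: sum.remove[of "carrier R" \<zero>] sum_nonzero)

text \<open>On a cyclic group of order \<open>N\<close> with \<open>d dvd N\<close>, the
  \<open>d\<close>-th power map is \<open>d\<close>-to-one onto the subgroup generated by
  \<open>gen [^] d\<close>: the summand has period \<open>N div d\<close> in the exponent.\<close>

lemma sum_nonzero_pow:
  fixes f :: "'a \<Rightarrow> 'c :: comm_semiring_1"
  assumes "d dvd N"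
  shows "(\<Sum>x\<in>carrier R - {\<zero>}. f (x [^] d)) = of_nat d * (\<Sum>i<N div d. f (gen [^] (d * i)))"
proof -
  have "(\<Sum>x\<in>carrier R - {\<zero>}. f (x [^] d)) = (\<Sum>i<d * (N div d). f (gen [^] (d * i)))"
    using assms by (simp add: sum_nonzero nat_pow_pow mult.commute)
  also have "\<dots> = of_nat d * (\<Sum>i<N div d. f (gen [^] (d * i)))"
  proof (rule sum_lessThan_periodic)
    fix i
    have "d * (i + N div d) = d * i + N" using assms by (simp add: algebra_simps)
    then show "f (gen [^] (d * (i + N div d))) = f (gen [^] (d * i))"
      by (simp add: nat_pow_mult[symmetric] pow_N)
  qed
  finally show ?thesis .
qed

text \<open>Apply \<open>sum_nonzero_pow\<close> to the indicator of \<open>\<one>\<close>: among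
  the exponents \<open>d * i\<close> with \<open>i < N div d\<close> only \<open>i = 0\<close> gives
  \<open>\<one>\<close>, and it is counted \<open>d\<close> times.\<close>

lemma card_roots_of_unity:
  assumes "d dvd N"
  shows "card {x \<in> carrier R - {\<zero>}. x [^] d = \<one>} = d"
proof -
  have d: "d > 0" using assms N_pos by (auto intro: Nat.gr0I)
  have "card {x \<in> carrier R - {\<zero>}. x [^] d = \<one>} = (\<Sum>x\<in>carrier R - {\<zero>}. of_bool (x [^] d = \<one>))"
    by (simp add: Int_def conj_commute)
  also have "\<dots> = d * (\<Sum>i<N div d. of_bool (gen [^] (d * i) = \<one>))"
    using sum_nonzero_pow[OF assms, of "\<lambda>x. of_bool (x = \<one>) :: nat"] by simp
  also have "(\<Sum>i<N div d. of_bool (gen [^] (d * i) = \<one>)) = (\<Sum>i<N div d. of_bool (i = 0) :: nat)"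
  proof (rule sum.cong[OF refl])
    fix i assume i: "i \<in> {..<N div d}"
    have "N dvd d * i \<longleftrightarrow> N div d dvd i" using assms d
      by (metis dvd_div_mult_self mult.commute nat_mult_dvd_cancel_disj neq0_conv)
    also have "\<dots> \<longleftrightarrow> i = 0" using i nat_dvd_not_less by auto
    finally show "of_bool (gen [^] (d * i) = \<one>) = (of_bool (i = 0) :: nat)" by (simp add: gen_pow_eq_one_iff)
  qed
  also have "\<dots> = 1"
    using assms N_pos d by (simp add: sum.If_cases of_bool_def Int_def dvd_imp_le div_greater_zero_iff)
  finally show ?thesis by simp
qed

text \<open>By Lagrange in the additive group, \<open>p ^ n\<close> annihilates
  \<open>\<one>\<close>. That multiple of \<open>\<one>\<close> is the \<open>n\<close>-th power of
  \<open>[p] \<cdot> \<one>\<close>, and a field has no nonzero nilpotents.\<close>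

lemma char_p: "[p] \<cdot> \<one> = \<zero>"
proof -
  have "[(p ^ n)] \<cdot> \<one> = \<zero>"
    using add.pow_order_eq_1[of \<one>] by (simp add: order_def card_carrier)
  moreover have "[(p ^ i)] \<cdot> \<one> = ([p] \<cdot> \<one>) [^] i" for i
  proof (induction i)
    case (Suc i)
    have "[(p ^ Suc i)] \<cdot> \<one> = [(p ^ i)] \<cdot> ([p] \<cdot> \<one>)"
      by (subst add.nat_pow_pow) (simp_all add: mult.commute)
    also have "\<dots> = ([(p ^ i)] \<cdot> \<one>) \<otimes> ([p] \<cdot> \<one>)" by (subst add_pow_ldistr) simp_all
    finally show ?case using Suc by simp
  qed simp
  ultimately show ?thesis using pow_neq_zero[of "[p] \<cdot> \<one>" n] by (metis add.nat_pow_closed one_closed)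
qed

lemma char_p': "p dvd m \<Longrightarrow> x \<in> carrier R \<Longrightarrow> [(m::nat)] \<cdot> x = \<zero>"
proof -
  assume m: "p dvd m" and x: "x \<in> carrier R"
  obtain c where c: "m = p * c" using m by auto
  have "[p] \<cdot> x = ([p] \<cdot> \<one>) \<otimes> x" using x by (simp add: add_pow_ldistr)
  then have "[p] \<cdot> x = \<zero>" using x by (simp add: char_p)
  then show ?thesis unfolding c using x add.nat_pow_pow[of x c p] by (simp add: mult.commute)
qed

lemma frobenius_add_p:
  assumes a: "a \<in> carrier R" and b: "b \<in> carrier R"
  shows "(a \<oplus> b) [^] p = a [^] p \<oplus> b [^] p"
proof -
  define T where "T k = [(p choose k)] \<cdot> (a [^] k \<otimes> b [^] (p - k))" for k
  have T[simp]: "T k \<in> carrier R" for k using a b by (simp add: T_def)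
  obtain m where m: "p = Suc m" using p_ge_2 by (cases p) auto
  have T0: "T 0 = b [^] p" using b by (simp add: T_def)
  have Tp: "T p = a [^] p" using a by (simp add: T_def)
  have Tk: "T k = \<zero>" if "0 < k" "k < p" for k
    \<comment> \<open>The inner binomial coefficients are divisible by the prime \<open>p\<close>,
      so only the two end terms survive.\<close>
    unfolding T_def by (rule char_p') (use a b that prime_p in \<open>auto intro: dvd_choose_prime\<close>)
  have "(a \<oplus> b) [^] p = finsum R T {..p}"
    using binomial_theorem[OF a b, of p] unfolding T_def .
  also have "\<dots> = finsum R T {0, p}"
    by (rule add.finprod_mono_neutral_cong_right) (use Tk in \<open>auto simp: Pi_def\<close>)
  also have "\<dots> = a [^] p \<oplus> b [^] p"
    using p_ge_2 a b by (subst finsum_insert) (auto simp: T0 Tp a_comm)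
  finally show ?thesis .
qed

lemma frobenius_add:
  assumes "a \<in> carrier R" "b \<in> carrier R"
  shows "(a \<oplus> b) [^] (p ^ i) = a [^] (p ^ i) \<oplus> b [^] (p ^ i)"
proof (induction i)
  case (Suc i)
  have "(a \<oplus> b) [^] (p ^ Suc i) = ((a \<oplus> b) [^] (p ^ i)) [^] p"
    using assms by (simp add: nat_pow_pow mult.commute)
  then show ?case using Suc assms by (simp add: frobenius_add_p nat_pow_pow mult.commute)
qed (use assms in simp)

lemma pow_card: "x \<in> carrier R \<Longrightarrow> x [^] (p ^ n) = x"
proof (cases "x = \<zero>")
  case False
  assume x: "x \<in> carrier R"
  have "x [^] (p ^ n) = x [^] (N + 1)" by (simp add: Suc_N)
  also have "\<dots> = x" using x False by (simp only: nat_pow_mult[symmetric]) (simp add: pow_N)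
  finally show ?thesis .
qed (use p_ge_2 in \<open>simp add: nat_pow_zero\<close>)

subsection \<open>An additive character\<close>

lemma mult_bij:
  assumes "c \<in> carrier R" "c \<noteq> \<zero>"
  shows "bij_betw (\<lambda>x. c \<otimes> x) (carrier R) (carrier R)"
proof -
  have "inj_on (\<lambda>x. c \<otimes> x) (carrier R)"
    using assms by (auto simp: inj_on_def m_lcancel)
  moreover have "(\<lambda>x. c \<otimes> x) ` carrier R \<subseteq> carrier R" using assms by auto
  ultimately show ?thesis
    unfolding bij_betw_def using endo_inj_surj[OF finite_carrier] by blast
qed

text \<open>Substituting \<open>gen \<otimes> x\<close> for \<open>x\<close> multiplies the sum by
  \<open>gen [^] j\<close>, which differs from \<open>\<one>\<close>.\<close>

lemma finsum_pow_eq_zero: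
  assumes "\<not> N dvd j"
  shows "(\<Oplus>x\<in>carrier R. x [^] j) = \<zero>"
proof -
  let ?S = "\<Oplus>x\<in>carrier R. x [^] j"
  have S: "?S \<in> carrier R" by (rule finsum_closed) auto
  have "?S = (\<Oplus>x\<in>(\<lambda>x. gen \<otimes> x) ` carrier R. x [^] j)"
    using mult_bij[of gen] by (simp add: bij_betw_def)
  also have "\<dots> = (\<Oplus>x\<in>carrier R. (gen \<otimes> x) [^] j)"
    by (rule finsum_reindex) (use mult_bij[of gen] in \<open>auto simp: bij_betw_def\<close>)
  also have "\<dots> = (\<Oplus>x\<in>carrier R. gen [^] j \<otimes> x [^] j)"
    by (rule finsum_cong') (auto simp: nat_pow_distrib)
  also have "\<dots> = gen [^] j \<otimes> ?S"
    by (rule finsum_rdistr[symmetric]) auto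
  finally have "(gen [^] j \<ominus> \<one>) \<otimes> ?S = \<zero>"
    using S by (metis gen_closed l_distr l_minus l_one minus_eq nat_pow_closed one_closed a_inv_closed r_neg)
  moreover have "gen [^] j \<ominus> \<one> \<noteq> \<zero>"
    using assms gen_pow_eq_one_iff by simp
  ultimately show ?thesis using S integral by (meson gen_closed minus_closed nat_pow_closed one_closed)
qed

text \<open>Every nonzero element contributes \<open>\<one>\<close>, and their number
  \<open>N = p ^ n - 1\<close> equals minus one in the field.\<close>

lemma finsum_pow_N: "(\<Oplus>x\<in>carrier R. x [^] N) \<noteq> \<zero>"
proof -
  have "(\<Oplus>x\<in>carrier R. x [^] N) = (\<Oplus>x\<in>carrier R - {\<zero>}. \<one>)"
    by (rule add.finprod_mono_neutral_cong_right)
      (use N_pos in \<open>auto simp: nat_pow_zero pow_N\<close>)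
  also have "\<dots> = [N] \<cdot> \<one>"
    by (simp add: add.finprod_const card_nonzero)
  finally have *: "(\<Oplus>x\<in>carrier R. x [^] N) = [N] \<cdot> \<one>" .
  have "[Suc N] \<cdot> \<one> = \<zero>" unfolding Suc_N by (rule char_p') (use n_pos in auto)
  then have "[N] \<cdot> \<one> \<oplus> \<one> = \<zero>" by simp
  then show ?thesis unfolding * by auto
qed

section \<open>The absolute trace and the prime field\<close>

definition trace :: "'a \<Rightarrow> 'a" where
  "trace x = (\<Oplus>i\<in>{..n - 1}. x [^] (p ^ i))"

lemma trace_closed [simp]: "x \<in> carrier R \<Longrightarrow> trace x \<in> carrier R"
  unfolding trace_def by (rule finsum_closed) auto

lemma trace_add: "x \<in> carrier R \<Longrightarrow> y \<in> carrier R \<Longrightarrow> trace (x \<oplus> y) = trace x \<oplus> trace y"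
  unfolding trace_def by (subst finsum_addf [symmetric]) (auto simp: frobenius_add)

lemma frobenius_finsum:
  assumes "finite A" "f \<in> A \<rightarrow> carrier R"
  shows "(\<Oplus>i\<in>A. f i) [^] p = (\<Oplus>i\<in>A. f i [^] p)"
  using assms
proof (induction A rule: finite_induct)
  case empty
  then show ?case using p_ge_2 by (simp add: nat_pow_zero)
next
  case (insert a A)
  then show ?case by (subst (1 2) finsum_insert) (auto simp: frobenius_add_p Pi_def)
qed

text \<open>Frobenius permutes the summands of the trace cyclically because
  \<open>x [^] (p ^ n) = x\<close>. The second equation places the trace in the prime field.\<close>

lemma trace_pow_p:
  assumes x: "x \<in> carrier R"
  shows "trace (x [^] p) = trace x" and "trace x [^] p = trace x"
proof -
  define m where "m = n - 1"
  have m: "n - 1 = m" "p ^ n = p ^ Suc m" using n_pos by (auto simp: m_def)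
  have e: "(x [^] p) [^] (p ^ i) = x [^] (p ^ Suc i)" for i
    using x by (simp add: nat_pow_pow)
  \<comment> \<open>Adding \<open>x\<close> completes the sum to the indices
    \<open>{..Suc m}\<close>; removing its last instead of its first term then gives the trace of
    \<open>x\<close> itself.\<close>
  have "trace (x [^] p) \<oplus> x = (\<Oplus>i\<in>{..m}. x [^] (p ^ Suc i)) \<oplus> x [^] (p ^ 0)"
    unfolding trace_def m e using x by simp
  also have "\<dots> = (\<Oplus>i\<in>{..Suc m}. x [^] (p ^ i))"
    by (rule finsum_Suc2[symmetric]) (use x in auto)
  also have "\<dots> = x [^] (p ^ n) \<oplus> trace x"
    unfolding trace_def m using x by (subst finsum_Suc) auto
  also have "\<dots> = trace x \<oplus> x" using x by (simp add: pow_card a_comm)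
  finally show 1: "trace (x [^] p) = trace x" using x by simp
  have "trace x [^] p = trace (x [^] p)"
    unfolding trace_def using x
    by (subst frobenius_finsum) (auto simp: nat_pow_pow mult.commute intro!: finsum_cong')
  then show "trace x [^] p = trace x" using 1 by simp
qed

text \<open>The power sums of all elements vanish in degrees not divisible by \<open>N\<close>; multiplying the
  trace by \<open>x\<close> to the power \<open>N - p ^ (n - 1)\<close> leaves exactly one term of degree \<open>N\<close>.\<close>
lemma trace_nonzero: "\<exists>x\<in>carrier R. trace x \<noteq> \<zero>"
proof (rule ccontr)
  assume "\<not> ?thesis"
  then have z: "trace x = \<zero>" if "x \<in> carrier R" for x using that by auto
  have pn: "p ^ n = p * p ^ (n - 1)" using n_pos by (cases n) auto
  have "2 * p ^ (n - 1) \<le> p ^ n" unfolding pn using p_ge_2 by simp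
  moreover have "p ^ (n - 1) > 0" using p_ge_2 by simp
  ultimately have le: "p ^ (n - 1) \<le> N" unfolding N_def by linarith
  define e where "e = N - p ^ (n - 1)"
  have expand: "x [^] e \<otimes> trace x = (\<Oplus>i\<in>{..n-1}. x [^] (e + p ^ i))" if x: "x \<in> carrier R" for x
  proof -
    have "x [^] e \<otimes> trace x = (\<Oplus>i\<in>{..n-1}. x [^] e \<otimes> x [^] (p ^ i))"
      unfolding trace_def by (rule finsum_rdistr) (use x in auto)
    then show ?thesis using x by (simp add: nat_pow_mult)
  qed
  have "\<zero> = (\<Oplus>x\<in>carrier R. x [^] e \<otimes> trace x)"
    using z by (subst add.finprod_one_eqI) auto
  also have "\<dots> = (\<Oplus>x\<in>carrier R. \<Oplus>i\<in>{..n-1}. x [^] (e + p ^ i))"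
    by (rule finsum_cong') (auto simp: expand intro!: finsum_closed)
  also have "\<dots> = (\<Oplus>i\<in>{..n-1}. \<Oplus>x\<in>carrier R. x [^] (e + p ^ i))"
    by (rule finsum_swap) auto
  also have "\<dots> = (\<Oplus>i\<in>{n-1}. \<Oplus>x\<in>carrier R. x [^] (e + p ^ i))"
  proof (rule add.finprod_mono_neutral_cong_right)
    show "(\<Oplus>x\<in>carrier R. x [^] (e + p ^ i)) = \<zero>" if "i \<in> {..n - 1} - {n - 1}" for i
    proof -
      from that have "p ^ i < p ^ (n - 1)" using p_ge_2 by (intro power_strict_increasing) auto
      then have "e + p ^ i < N" unfolding e_def using le by linarith
      moreover have "e + p ^ i > 0" using p_ge_2 by simp
      ultimately have "\<not> N dvd (e + p ^ i)" by (intro nat_dvd_not_less)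
      then show ?thesis by (rule finsum_pow_eq_zero)
    qed
  qed (auto intro!: finsum_closed)
  also have "\<dots> = (\<Oplus>x\<in>carrier R. x [^] N)"
    using le by (subst finsum_insert) (auto simp: e_def intro!: finsum_closed)
  finally show False using finsum_pow_N by simp
qed

text \<open>The fixed points are zero and the roots of unity of order dividing \<open>P - 1\<close>.
  The bound is used for the prime field and for the subfields of order \<open>p ^ r\<close> and
  \<open>p ^ (2 * r)\<close>.\<close>

lemma card_frobenius_fixed:
  assumes "P \<ge> 2" "P - 1 dvd N"
  shows "card {x \<in> carrier R. x [^] P = x} = P"
proof -
  have iff: "x [^] P = x \<longleftrightarrow> x [^] (P - 1) = \<one>" if "x \<in> carrier R" "x \<noteq> \<zero>" for x
  proof -
    have "x [^] P = x [^] Suc (P - 1)" using assms by simp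
    also have "\<dots> = x [^] (P - 1) \<otimes> x" by simp
    finally show ?thesis using that
      by (metis l_one m_rcancel nat_pow_closed one_closed)
  qed
  have "{x \<in> carrier R. x [^] P = x} = insert \<zero> {x \<in> carrier R - {\<zero>}. x [^] (P - 1) = \<one>}"
    using assms iff by (auto simp: nat_pow_zero)
  also have "card \<dots> = P"
    using assms card_roots_of_unity[of "P - 1"] by (subst card_insert_disjoint) auto
  finally show ?thesis .
qed

lemma nat_mult_one_eq_zero_iff: "[(m::nat)] \<cdot> \<one> = \<zero> \<longleftrightarrow> p dvd m"
proof
  assume m: "[m] \<cdot> \<one> = \<zero>"
  show "p dvd m"
  proof (rule ccontr)
    assume "\<not> p dvd m"
    then have "coprime m p" using prime_p by (metis coprime_commute prime_imp_coprime)
    moreover have "m \<noteq> 0" using \<open>\<not> p dvd m\<close> by (intro notI) simp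
    ultimately obtain x y where "m * x = p * y + 1" using bezout_nat[of m p] by auto
    then have "[(m * x)] \<cdot> \<one> = [(p * y)] \<cdot> \<one> \<oplus> \<one>" by simp
    also have "[(p * y)] \<cdot> \<one> = \<zero>" by (rule char_p') auto
    also have "[(m * x)] \<cdot> \<one> = [x] \<cdot> ([m] \<cdot> \<one>)" by (subst add.nat_pow_pow) (simp_all add: mult.commute)
    finally show False using m by simp
  qed
qed (simp add: char_p')

lemma nat_mult_one_eq_iff: "[(a::nat)] \<cdot> \<one> = [b] \<cdot> \<one> \<longleftrightarrow> a mod p = b mod p"
proof (induction a b rule: linorder_wlog)
  case (le a b)
  have "[b] \<cdot> \<one> = [a] \<cdot> \<one> \<oplus> [(b - a)] \<cdot> \<one>"
    using le by (subst add.nat_pow_mult) auto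
  then have "[a] \<cdot> \<one> = [b] \<cdot> \<one> \<longleftrightarrow> [(b - a)] \<cdot> \<one> = \<zero>" by simp
  also have "\<dots> \<longleftrightarrow> a mod p = b mod p"
    unfolding nat_mult_one_eq_zero_iff using le by (metis mod_eq_dvd_iff_nat)
  finally show ?case .
qed metis

text \<open>The \<open>p\<close> multiples of \<open>\<one>\<close> are distinct and fixed by
  Frobenius, and Frobenius has only \<open>p\<close> fixed points.\<close>

lemma prime_field:
  assumes "x \<in> carrier R" "x [^] p = x"
  shows "\<exists>j<p. x = [j] \<cdot> \<one>"
proof -
  have "p - 1 dvd N" unfolding N_def using p_ge_2 by (intro pred_dvd_power_pred) simp
  then have c: "card {x \<in> carrier R. x [^] p = x} = p" using card_frobenius_fixed p_ge_2 by auto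
  have "inj_on (\<lambda>j::nat. [j] \<cdot> \<one>) {..<p}" by (auto simp: inj_on_def nat_mult_one_eq_iff)
  then have c': "card ((\<lambda>j::nat. [j] \<cdot> \<one>) ` {..<p}) = p" by (simp add: card_image)
  have f: "([j] \<cdot> \<one>) [^] p = [j] \<cdot> \<one>" for j :: nat
    by (induction j) (use p_ge_2 in \<open>auto simp: nat_pow_zero frobenius_add_p\<close>)
  have "(\<lambda>j::nat. [j] \<cdot> \<one>) ` {..<p} = {x \<in> carrier R. x [^] p = x}"
    by (rule card_subset_eq) (auto simp: f c c')
  then show ?thesis using assms by auto
qed

definition trace_nat :: "'a \<Rightarrow> nat" where
  "trace_nat x = (SOME j. j < p \<and> trace x = [j] \<cdot> \<one>)"

lemma trace_nat:
  assumes "x \<in> carrier R"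
  shows "trace_nat x < p" "trace x = [(trace_nat x)] \<cdot> \<one>"
proof -
  have "\<exists>j. j < p \<and> trace x = [j] \<cdot> \<one>"
    using prime_field[of "trace x"] assms by (auto simp: trace_pow_p)
  from someI_ex[OF this] show "trace_nat x < p" "trace x = [(trace_nat x)] \<cdot> \<one>"
    by (auto simp: trace_nat_def)
qed

section \<open>The additive character and its orthogonality relations\<close>

definition psi :: "'a \<Rightarrow> complex" where
  "psi x = cis (2 * pi * real (trace_nat x) / real p)"

lemma psi_add:
  assumes "x \<in> carrier R" "y \<in> carrier R"
  shows "psi (x \<oplus> y) = psi x * psi y"
proof -
  define w where "w = cis (2 * pi / real p)"
  have psi: "psi x = w ^ trace_nat x" for x
    by (simp add: psi_def w_def DeMoivre mult_ac)
  \<comment> \<open>\<open>trace_nat\<close> is additive only modulo \<open>p\<close>; this relation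
    absorbs the carry.\<close>
  have "w ^ p = 1" using p_ge_2 by (simp add: w_def DeMoivre)
  then have w: "w ^ (i mod p) = w ^ i" for i
    by (metis mod_mult_div_eq power_add power_mult power_one mult.right_neutral)
  have "[(trace_nat (x \<oplus> y))] \<cdot> \<one> = [(trace_nat x + trace_nat y)] \<cdot> \<one>"
    using assms trace_nat(2)[of "x \<oplus> y"] trace_nat(2)[of x] trace_nat(2)[of y]
    by (simp add: trace_add add.nat_pow_mult)
  then have "trace_nat (x \<oplus> y) mod p = (trace_nat x + trace_nat y) mod p"
    by (simp add: nat_mult_one_eq_iff)
  then show ?thesis unfolding psi by (metis w power_add)
qed

lemma norm_psi [simp]: "norm (psi x) = 1"
  by (simp add: psi_def)

lemma psi_nonzero [simp]: "psi x \<noteq> 0"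
  using norm_psi[of x] by (metis norm_zero zero_neq_one)

lemma psi_zero [simp]: "psi \<zero> = 1"
  using psi_add[of \<zero> \<zero>] by simp

text \<open>Inherited from the trace. It later allows a term in \<open>y [^] P\<close> to be
  replaced by a term linear in \<open>y\<close>.\<close>

lemma psi_frobenius: "x \<in> carrier R \<Longrightarrow> psi (x [^] (p ^ i)) = psi x"
proof (induction i)
  case (Suc i)
  have "x [^] (p ^ Suc i) = (x [^] (p ^ i)) [^] p" using Suc by (simp add: nat_pow_pow mult.commute)
  moreover have "psi (y [^] p) = psi y" if "y \<in> carrier R" for y
    using that by (simp add: psi_def trace_nat_def trace_pow_p)
  ultimately show ?case using Suc by simp
qed simp

lemma psi_nontrivial: "\<exists>x\<in>carrier R. psi x \<noteq> 1"
proof -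
  obtain x where x: "x \<in> carrier R" "trace x \<noteq> \<zero>" using trace_nonzero by auto
  have "bij_betw (\<lambda>k. cis (2 * pi * real k / real p)) {..<p} {z. z ^ p = 1}"
    using bij_betw_roots_unity p_ge_2 by simp
  then have "inj_on (\<lambda>k. cis (2 * pi * real k / real p)) {..<p}" by (rule bij_betw_imp_inj_on)
  then have "psi x \<noteq> cis (2 * pi * real 0 / real p)"
    unfolding psi_def using trace_nat[OF x(1)] x(2) p_ge_2
    by (metis (mono_tags, lifting) add.nat_pow_0 gr_zeroI inj_onD lessThan_iff not_numeral_le_zero)
  then show ?thesis using x by auto
qed

text \<open>Translation by an element with \<open>\<chi> a \<noteq> 1\<close> permutes the finite
  set \<open>A\<close> and multiplies the sum by \<open>\<chi> a\<close>. The character need only be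
  multiplicative on \<open>A\<close>, which admits the restriction of a quadratic form to its
  radical.\<close>

lemma sum_additive_character:
  fixes \<chi> :: "'a \<Rightarrow> complex"
  assumes A: "A \<subseteq> carrier R" "\<And>x y. x \<in> A \<Longrightarrow> y \<in> A \<Longrightarrow> x \<oplus> y \<in> A"
    and hom: "\<And>x y. x \<in> A \<Longrightarrow> y \<in> A \<Longrightarrow> \<chi> (x \<oplus> y) = \<chi> x * \<chi> y"
  shows "sum \<chi> A = (if \<forall>x\<in>A. \<chi> x = 1 then of_nat (card A) else 0)"
proof (cases "\<forall>x\<in>A. \<chi> x = 1")
  case False
  then obtain a where a: "a \<in> A" "\<chi> a \<noteq> 1" by auto
  have "inj_on (\<lambda>x. a \<oplus> x) A" using A a by (auto simp: inj_on_def subset_iff)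
  moreover have "(\<lambda>x. a \<oplus> x) ` A \<subseteq> A" using A a by auto
  ultimately have bij: "bij_betw (\<lambda>x. a \<oplus> x) A A"
    unfolding bij_betw_def using endo_inj_surj finite_subset[OF A(1) finite_carrier] by blast
  have "sum \<chi> A = (\<Sum>x\<in>A. \<chi> (a \<oplus> x))"
    by (rule sum.reindex_bij_betw[OF bij, symmetric])
  also have "\<dots> = \<chi> a * sum \<chi> A" using hom a by (simp add: sum_distrib_left)
  finally have "sum \<chi> A = 0" using a(2) by simp
  then show ?thesis by (simp only: if_not_P[OF False])
qed simp

lemma psi_nondegenerate:
  assumes "a \<in> carrier R" "\<And>y. y \<in> carrier R \<Longrightarrow> psi (a \<otimes> y) = 1"
  shows "a = \<zero>"
proof (rule ccontr)
  assume "a \<noteq> \<zero>"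
  obtain x where x: "x \<in> carrier R" "psi x \<noteq> 1" using psi_nontrivial by auto
  have "x \<in> (\<lambda>y. a \<otimes> y) ` carrier R"
    using mult_bij[OF assms(1) \<open>a \<noteq> \<zero>\<close>] x by (simp add: bij_betw_def)
  then show False using assms(2) x by auto
qed

lemma sum_psi:
  assumes a: "a \<in> carrier R"
  shows "(\<Sum>y\<in>carrier R. psi (a \<otimes> y)) = (if a = \<zero> then of_nat (p ^ n) else 0)"
proof -
  have "(\<Sum>y\<in>carrier R. psi (a \<otimes> y)) =
      (if \<forall>y\<in>carrier R. psi (a \<otimes> y) = 1 then of_nat (card (carrier R)) else 0)"
    by (rule sum_additive_character) (use a in \<open>auto simp: r_distr psi_add\<close>)
  also have "(\<forall>y\<in>carrier R. psi (a \<otimes> y) = 1) \<longleftrightarrow> a = \<zero>"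
    using psi_nondegenerate[OF a] by auto
  finally show ?thesis by (simp add: card_carrier)
qed

end

subsection \<open>Power sums of the character\<close>

text \<open>The square determines \<open>m\<close> up to sign. Since \<open>(- int P) ^ j\<close> is
  itself 1 modulo \<open>P + 1\<close>, the wrong sign would make \<open>P + 1\<close>, which is at
  least 3, divide 2.\<close>

lemma int_eq_minus_power:
  fixes m :: int and P :: nat
  assumes "P \<ge> 2" "m\<^sup>2 = int P ^ (2 * j)" "int P + 1 dvd m - 1"
  shows "m = (- int P) ^ j"
proof (rule ccontr)
  define u where "u = (- int P) ^ j"
  assume "m \<noteq> (- int P) ^ j"
  moreover have "m\<^sup>2 = u\<^sup>2" using assms(2) by (simp add: u_def power_mult[symmetric] mult.commute power_minus_Bit0)
  ultimately have "m = - u" by (auto simp: power2_eq_iff u_def)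
  have "- int P - 1 dvd (- int P) ^ j - 1" by (metis dvd_triv_left power_diff_1_eq)
  then have "int P + 1 dvd u - 1" by (simp add: u_def) (metis minus_diff_eq minus_dvd_iff add.commute diff_minus_eq_add)
  moreover have "int P + 1 dvd - u - 1" using assms(3) \<open>m = - u\<close> by simp
  ultimately have "int P + 1 dvd (u - 1) + (- u - 1)" by (rule dvd_add)
  then have "int P + 1 dvd 2" by simp
  then show False using assms(1) zdvd_imp_le by fastforce
qed

context finite_field
begin

definition gsum :: "nat \<Rightarrow> 'a \<Rightarrow> complex" where
  "gsum d t = (\<Sum>x\<in>carrier R. psi (t \<otimes> x [^] d))"

lemma gsum_zero: "gsum d \<zero> = of_nat (p ^ n)"
  by (simp add: gsum_def card_carrier)

text \<open>The sum on the right is a Gaussian period: the character summed over a coset of the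
  \<open>d\<close>-th powers (for nonzero \<open>t\<close>).\<close>

lemma gsum_eq:
  assumes "d dvd N" "t \<in> carrier R"
  shows "gsum d t = 1 + of_nat d * (\<Sum>i<N div d. psi (t \<otimes> gen [^] (d * i)))"
proof -
  have "d \<noteq> 0" using assms N_pos by (intro notI) simp
  then have "gsum d t = 1 + (\<Sum>x\<in>carrier R - {\<zero>}. psi (t \<otimes> x [^] d))"
    using assms by (simp add: gsum_def sum.remove[of "carrier R" \<zero>] nat_pow_zero)
  then show ?thesis using sum_nonzero_pow[OF assms(1), of "\<lambda>x. psi (t \<otimes> x)"] by simp
qed

text \<open>Summed over all \<open>t\<close>, orthogonality leaves only \<open>x = \<zero>\<close>,
  which contributes \<open>p ^ n\<close>. The term \<open>t = \<zero>\<close> already accounts for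
  all of this.\<close>

lemma sum_gsum:
  assumes "d > 0"
  shows "(\<Sum>i<N. gsum d (gen [^] i)) = 0"
proof -
  have "(\<Sum>t\<in>carrier R. gsum d t) = (\<Sum>x\<in>carrier R. \<Sum>t\<in>carrier R. psi (t \<otimes> x [^] d))"
    unfolding gsum_def by (rule sum.swap)
  also have "\<dots> = (\<Sum>x\<in>carrier R. \<Sum>t\<in>carrier R. psi (x [^] d \<otimes> t))"
    by (intro sum.cong refl) (simp add: m_comm)
  also have "\<dots> = (\<Sum>x\<in>carrier R. if x = \<zero> then of_nat (p ^ n) else 0)"
    by (intro sum.cong refl) (use assms in \<open>auto simp: sum_psi nat_pow_zero pow_neq_zero\<close>)
  also have "\<dots> = of_nat (p ^ n)" by simp
  finally show ?thesis by (simp add: sum_carrier gsum_zero)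
qed

lemma gsum_mult_power:
  assumes "t \<in> carrier R" "y \<in> carrier R" "y \<noteq> \<zero>"
  shows "gsum d (t \<otimes> y [^] d) = gsum d t"
proof -
  have "gsum d t = (\<Sum>x\<in>carrier R. psi (t \<otimes> (y \<otimes> x) [^] d))"
    unfolding gsum_def by (rule sum.reindex_bij_betw[OF mult_bij, symmetric]) (use assms in auto)
  then show ?thesis using assms by (simp add: gsum_def nat_pow_distrib m_assoc)
qed

lemma gsum_gen_periodic: "gsum d (gen [^] (i + d)) = gsum d (gen [^] i)"
  using gsum_mult_power[of "gen [^] i" gen d] by (simp add: nat_pow_mult)

end

section \<open>Exponential sums with exponent \<open>P + 1\<close>\<close>

locale square_field = finite_field +
  fixes r k :: nat
  assumes r_pos: "r > 0" and k_pos: "k > 0" and n_eq: "n = 2 * r * k"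
begin

definition P :: nat where "P = p ^ r"

lemma P_ge_2: "P \<ge> 2"
  using p_ge_2 r_pos unfolding P_def by (metis le_trans self_le_power Suc_leI One_nat_def one_le_numeral)

lemma card_eq_P: "p ^ n = P ^ (2 * k)"
  by (simp add: P_def n_eq power_mult[symmetric] mult_ac)

lemma P2_dvd: "P\<^sup>2 - 1 dvd N"
  unfolding N_def card_eq_P power_mult using P_ge_2 by (intro pred_dvd_power_pred) simp

lemma P2_eq: "P\<^sup>2 - 1 = (P - 1) * (P + 1)"
  using P_ge_2 by (cases P) (auto simp: power2_eq_square)

lemma Suc_P_dvd: "P + 1 dvd N" and P_pred_dvd: "P - 1 dvd N"
  using P2_dvd unfolding P2_eq by (auto intro: dvd_mult_left dvd_mult_right)

lemma frobenius_P:
  "x \<in> carrier R \<Longrightarrow> y \<in> carrier R \<Longrightarrow> (x \<oplus> y) [^] P = x [^] P \<oplus> y [^] P"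
  unfolding P_def by (rule frobenius_add)

text \<open>The nonzero \<open>(P+1)\<close>-st powers are a union of orbits under the subfield of order \<open>P\<close>, and each
  orbit contributes \<open>P - 1\<close> or \<open>-1\<close>.\<close>
lemma gsum_integer:
  assumes t: "t \<in> carrier R"
  shows "\<exists>z::int. gsum (P + 1) t = 1 + of_nat (P + 1) * of_int z"
proof -
  define M where "M = N div (P\<^sup>2 - 1)"
  have N: "N = (P + 1) * ((P - 1) * M)"
  proof -
    have "N = (P\<^sup>2 - 1) * M" by (simp only: M_def dvd_mult_div_cancel[OF P2_dvd])
    then show ?thesis by (simp only: P2_eq mult_ac)
  qed
  have M: "M > 0" using N N_pos by (intro Nat.gr0I) simp
  define K where "K = {x \<in> carrier R. x [^] P = x}"
  \<comment> \<open>As \<open>N = (P + 1) * ((P - 1) * M)\<close>, the element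
    \<open>gen [^] ((P + 1) * M)\<close> has order \<open>P - 1\<close>. Its powers are exactly the
    nonzero elements of the subfield \<open>K\<close> of order \<open>P\<close>.\<close>
  define h where "h = (\<lambda>m::nat. gen [^] ((P + 1) * (m * M)))"
  have cardK: "card K = P" unfolding K_def by (rule card_frobenius_fixed) (use P_ge_2 P_pred_dvd in auto)
  have K: "K \<subseteq> carrier R" "\<zero> \<in> K" using P_ge_2 by (auto simp: K_def nat_pow_zero)
  have Kadd: "x \<oplus> y \<in> K" if "x \<in> K" "y \<in> K" for x y
    using that by (auto simp: K_def frobenius_P)
  have inj: "inj_on h {..<P - 1}"
  proof (rule inj_onI)
    fix a b assume *: "a \<in> {..<P - 1}" "b \<in> {..<P - 1}" "h a = h b"
    have "(P + 1) * (a * M) \<in> {..<N}" if "a \<in> {..<P - 1}" for a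
      using that M unfolding N lessThan_iff by (intro mult_strict_left_mono mult_strict_right_mono) auto
    then have "(P + 1) * (a * M) = (P + 1) * (b * M)"
      using *  bij_gen_pow by (auto simp: h_def bij_betw_def dest: inj_onD)
    then have "a * M = b * M" by (metis nat_mult_eq_cancel1 zero_less_Suc Suc_eq_plus1)
    then show "a = b" using M by simp
  qed
  have hK: "h m \<in> K - {\<zero>}" for m
  proof -
    have "(P + 1) * (m * M) * P = (P + 1) * (m * M) + N * m"
    proof -
      have "(P + 1) * (m * M) * P = (P + 1) * (m * M) * (1 + (P - 1))" using P_ge_2 by simp
      also have "\<dots> = (P + 1) * (m * M) + N * m" unfolding N by (simp only: ring_distribs mult_ac mult_1_right)
      finally show ?thesis .
    qed
    then have "h m [^] P = gen [^] ((P + 1) * (m * M) + N * m)"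
      unfolding h_def by (simp only: nat_pow_pow gen_closed)
    also have "\<dots> = h m"
      unfolding h_def by (simp only: nat_pow_mult[symmetric] gen_closed nat_pow_pow[symmetric]) (simp add: pow_N)
    finally show ?thesis by (simp add: K_def h_def)
  qed
  have finK: "finite K" using finite_subset[OF K(1) finite_carrier] .
  have bij: "bij_betw h {..<P - 1} (K - {\<zero>})"
    unfolding bij_betw_def
  proof
    show "h ` {..<P - 1} = K - {\<zero>}"
    proof (rule card_subset_eq)
      show "card (h ` {..<P - 1}) = card (K - {\<zero>})"
        using inj K cardK by (simp add: card_image card_Diff_singleton)
    qed (use hK finK in auto)
  qed (rule inj)
  have inner: "\<exists>z::int. (\<Sum>m<P - 1. psi (w \<otimes> h m)) = of_int z" if w: "w \<in> carrier R" for w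
  proof -
    have "(\<Sum>m<P - 1. psi (w \<otimes> h m)) = (\<Sum>a\<in>K - {\<zero>}. psi (w \<otimes> a))"
      by (rule sum.reindex_bij_betw[OF bij])
    also have "\<dots> = (\<Sum>a\<in>K. psi (w \<otimes> a)) - 1"
      using K finK w by (simp add: sum_diff1)
    also have "(\<Sum>a\<in>K. psi (w \<otimes> a)) = (if \<forall>a\<in>K. psi (w \<otimes> a) = 1 then of_nat (card K) else 0)"
      by (rule sum_additive_character) (use K Kadd w in \<open>auto simp: r_distr psi_add subset_iff\<close>)
    also have "\<dots> - 1 = of_int (if \<forall>a\<in>K. psi (w \<otimes> a) = 1 then int (card K) - 1 else -1)" by simp
    finally show ?thesis by blast
  qed
  have "(\<Sum>i<N div (P + 1). psi (t \<otimes> gen [^] ((P + 1) * i))) =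
      (\<Sum>j<M. \<Sum>m<P - 1. psi (t \<otimes> gen [^] ((P + 1) * (j + m * M))))"
    unfolding N by (simp add: sum_lessThan_mult del: mult_Suc)
  also have "\<dots> = (\<Sum>j<M. \<Sum>m<P - 1. psi ((t \<otimes> gen [^] ((P + 1) * j)) \<otimes> h m))"
    using t by (intro sum.cong refl) (simp add: h_def m_assoc nat_pow_mult distrib_left del: mult_Suc)
  finally have eq: "(\<Sum>i<N div (P + 1). psi (t \<otimes> gen [^] ((P + 1) * i))) =
      (\<Sum>j<M. \<Sum>m<P - 1. psi ((t \<otimes> gen [^] ((P + 1) * j)) \<otimes> h m))" .
  have "\<exists>z. \<forall>j. (\<Sum>m<P - 1. psi ((t \<otimes> gen [^] ((P + 1) * j)) \<otimes> h m)) = of_int (z j)"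
    by (rule choice) (use inner t in auto)
  then obtain z where "\<And>j. (\<Sum>m<P - 1. psi ((t \<otimes> gen [^] ((P + 1) * j)) \<otimes> h m)) = of_int (z j)"
    by auto
  then have "gsum (P + 1) t = 1 + of_nat (P + 1) * of_int (\<Sum>j<M. z j)"
    unfolding gsum_eq[OF Suc_P_dvd t] eq by simp
  then show ?thesis by blast
qed

text \<open>The exponent \<open>p ^ (n - r)\<close> takes the \<open>P\<close>-th root.\<close>
definition polar :: "'a \<Rightarrow> 'a \<Rightarrow> 'a" where
  "polar t z = t \<otimes> z [^] P \<oplus> (t \<otimes> z) [^] (p ^ (n - r))"

lemma polar_closed [simp]: "t \<in> carrier R \<Longrightarrow> z \<in> carrier R \<Longrightarrow> polar t z \<in> carrier R"
  by (simp add: polar_def)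

lemma polar_add:
  "t \<in> carrier R \<Longrightarrow> x \<in> carrier R \<Longrightarrow> y \<in> carrier R \<Longrightarrow> polar t (x \<oplus> y) = polar t x \<oplus> polar t y"
  by (simp add: polar_def frobenius_P r_distr frobenius_add a_ac)

lemma root_P:
  assumes "x \<in> carrier R"
  shows "(x [^] (p ^ (n - r))) [^] P = x"
proof -
  have "r \<le> n" using k_pos by (simp add: n_eq)
  then have "p ^ (n - r) * P = p ^ n" by (simp add: P_def power_add[symmetric])
  then show ?thesis using assms by (simp add: nat_pow_pow pow_card)
qed

text \<open>\<open>x \<mapsto> tx\<^sup>P\<^sup>+\<^sup>1\<close> behaves like a quadratic form under \<open>psi\<close>, with associated bilinear form
  \<open>psi (polar t x \<otimes> y)\<close>.\<close>
lemma psi_power_add: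
  assumes t: "t \<in> carrier R" and z: "z \<in> carrier R" and y: "y \<in> carrier R"
  shows "psi (t \<otimes> (z \<oplus> y) [^] (P + 1)) =
    psi (t \<otimes> z [^] (P + 1)) * psi (t \<otimes> y [^] (P + 1)) * psi (polar t z \<otimes> y)"
proof -
  let ?w = "(t \<otimes> z) [^] (p ^ (n - r))"
  have zP: "z [^] P \<in> carrier R" and yP: "y [^] P \<in> carrier R" using z y by auto
  \<comment> \<open>This cross term is not linear in \<open>y\<close>, but it is the
    \<open>P\<close>-th power of \<open>?w \<otimes> y\<close>, which is, and \<open>psi\<close>
    does not distinguish the two.\<close>
  have "t \<otimes> z \<otimes> y [^] P = (?w \<otimes> y) [^] P"
    using t z y root_P[of "t \<otimes> z"] by (simp add: nat_pow_distrib)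
  then have w: "psi (t \<otimes> z \<otimes> y [^] P) = psi (?w \<otimes> y)"
    using t z y unfolding P_def by (simp add: psi_frobenius)
  have "t \<otimes> (z \<oplus> y) [^] (P + 1) = t \<otimes> ((z [^] P \<oplus> y [^] P) \<otimes> (z \<oplus> y))"
    using z y by (simp add: frobenius_P)
  also have "\<dots> = (t \<otimes> (z [^] P \<otimes> z) \<oplus> t \<otimes> (y [^] P \<otimes> y)) \<oplus> (t \<otimes> z [^] P \<otimes> y \<oplus> t \<otimes> z \<otimes> y [^] P)"
    using t z y zP yP by algebra
  finally have "psi (t \<otimes> (z \<oplus> y) [^] (P + 1)) =
    psi (t \<otimes> z [^] (P + 1)) * psi (t \<otimes> y [^] (P + 1)) * (psi (t \<otimes> z [^] P \<otimes> y) * psi (t \<otimes> z \<otimes> y [^] P))"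
    using t z y by (simp add: psi_add)
  also have "psi (t \<otimes> z [^] P \<otimes> y) * psi (t \<otimes> z \<otimes> y [^] P) = psi (polar t z \<otimes> y)"
    unfolding w polar_def using t z y by (simp add: psi_add l_distr)
  finally show ?thesis .
qed

definition radical :: "'a \<Rightarrow> 'a set" where
  "radical t = {z \<in> carrier R. polar t z = \<zero>}"

text \<open>Put \<open>x = z \<oplus> y\<close> in the double sum. The factor depending on
  \<open>y\<close> alone cancels against its conjugate, and summing the bilinear factor over
  \<open>y\<close> leaves only those \<open>z\<close> in the radical.\<close>

lemma gsum_norm:
  assumes t: "t \<in> carrier R"
  shows "gsum (P + 1) t * cnj (gsum (P + 1) t) =
    of_nat (p ^ n) * (\<Sum>z\<in>radical t. psi (t \<otimes> z [^] (P + 1)))"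
proof -
  have "gsum (P + 1) t * cnj (gsum (P + 1) t) =
      (\<Sum>y\<in>carrier R. \<Sum>x\<in>carrier R. psi (t \<otimes> x [^] (P + 1)) * cnj (psi (t \<otimes> y [^] (P + 1))))"
    unfolding gsum_def cnj_sum sum_product by (rule sum.swap)
  also have "\<dots> = (\<Sum>y\<in>carrier R. \<Sum>z\<in>carrier R. psi (t \<otimes> z [^] (P + 1)) * psi (polar t z \<otimes> y))"
  proof (rule sum.cong[OF refl])
    fix y assume y: "y \<in> carrier R"
    have bij: "bij_betw (\<lambda>z. z \<oplus> y) (carrier R) (carrier R)"
      by (rule bij_betw_byWitness[where f' = "\<lambda>z. z \<ominus> y"])
        (use y in \<open>auto simp: minus_eq a_assoc r_neg l_neg\<close>)
    have 1: "psi (t \<otimes> y [^] (P + 1)) * cnj (psi (t \<otimes> y [^] (P + 1))) = 1"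
      using complex_norm_square[of "psi (t \<otimes> y [^] (P + 1))"] by simp
    have "(\<Sum>x\<in>carrier R. psi (t \<otimes> x [^] (P + 1)) * cnj (psi (t \<otimes> y [^] (P + 1)))) =
       (\<Sum>z\<in>carrier R. psi (t \<otimes> (z \<oplus> y) [^] (P + 1)) * cnj (psi (t \<otimes> y [^] (P + 1))))"
      by (rule sum.reindex_bij_betw[OF bij, symmetric])
    also have "\<dots> = (\<Sum>z\<in>carrier R. psi (t \<otimes> z [^] (P + 1)) * psi (polar t z \<otimes> y) *
        (psi (t \<otimes> y [^] (P + 1)) * cnj (psi (t \<otimes> y [^] (P + 1)))))"
      using t y by (intro sum.cong refl) (simp only: psi_power_add mult_ac)
    finally show "(\<Sum>x\<in>carrier R. psi (t \<otimes> x [^] (P + 1)) * cnj (psi (t \<otimes> y [^] (P + 1)))) =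
       (\<Sum>z\<in>carrier R. psi (t \<otimes> z [^] (P + 1)) * psi (polar t z \<otimes> y))"
      unfolding 1 by simp
  qed
  also have "\<dots> = (\<Sum>z\<in>carrier R. \<Sum>y\<in>carrier R. psi (t \<otimes> z [^] (P + 1)) * psi (polar t z \<otimes> y))"
    by (rule sum.swap)
  also have "\<dots> = (\<Sum>z\<in>carrier R. psi (t \<otimes> z [^] (P + 1)) * (if polar t z = \<zero> then of_nat (p ^ n) else 0))"
    using t by (simp add: sum_distrib_left[symmetric] sum_psi)
  also have "\<dots> = (\<Sum>z\<in>carrier R. if polar t z = \<zero> then of_nat (p ^ n) * psi (t \<otimes> z [^] (P + 1)) else 0)"
    by (intro sum.cong refl) simp
  also have "\<dots> = of_nat (p ^ n) * (\<Sum>z\<in>radical t. psi (t \<otimes> z [^] (P + 1)))"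
    unfolding radical_def sum_distrib_left by (rule sum.inter_filter[symmetric]) simp
  finally show ?thesis .
qed

text \<open>The bilinear form is trivial on the radical, so there the quadratic form becomes an
  additive character.\<close>

lemma sum_radical:
  assumes t: "t \<in> carrier R"
  shows "(\<Sum>z\<in>radical t. psi (t \<otimes> z [^] (P + 1))) =
    (if \<forall>z\<in>radical t. psi (t \<otimes> z [^] (P + 1)) = 1 then of_nat (card (radical t)) else 0)"
proof (rule sum_additive_character)
  show "x \<oplus> y \<in> radical t" if "x \<in> radical t" "y \<in> radical t" for x y
    using that t by (simp add: radical_def polar_add)
  show "psi (t \<otimes> (x \<oplus> y) [^] (P + 1)) = psi (t \<otimes> x [^] (P + 1)) * psi (t \<otimes> y [^] (P + 1))"
    if "x \<in> radical t" "y \<in> radical t" for x y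
    using that t psi_power_add[OF t, of x y] by (simp add: radical_def)
qed (auto simp: radical_def)

text \<open>Taking the \<open>P\<close>-th power removes the root from \<open>polar\<close> and
  loses nothing, since only zero has \<open>P\<close>-th power zero.\<close>

lemma radical_eq:
  assumes t: "t \<in> carrier R"
  shows "radical t = {z \<in> carrier R. t [^] P \<otimes> z [^] (P\<^sup>2) \<oplus> t \<otimes> z = \<zero>}"
proof -
  have "polar t z = \<zero> \<longleftrightarrow> t [^] P \<otimes> z [^] (P\<^sup>2) \<oplus> t \<otimes> z = \<zero>" if z: "z \<in> carrier R" for z
  proof -
    have "polar t z [^] P = t [^] P \<otimes> z [^] (P\<^sup>2) \<oplus> t \<otimes> z"
      unfolding polar_def using t z root_P[of "t \<otimes> z"]
      by (simp add: frobenius_P) (simp add: nat_pow_distrib nat_pow_pow power2_eq_square)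
    moreover have "polar t z [^] P = \<zero> \<longleftrightarrow> polar t z = \<zero>"
      using t z P_ge_2 pow_neq_zero[of "polar t z" P] by (auto simp: nat_pow_zero)
    ultimately show ?thesis by simp
  qed
  then show ?thesis by (auto simp: radical_def)
qed

text \<open>Two nonzero solutions of the equation in \<open>radical_eq\<close> differ by a factor
  fixed by the \<open>P\<^sup>2\<close>-power map. A nonzero radical is thus a line over the
  subfield of order \<open>P\<^sup>2\<close>.\<close>

lemma card_radical:
  assumes t: "t \<in> carrier R" "t \<noteq> \<zero>"
  shows "card (radical t) = 1 \<or> card (radical t) = P\<^sup>2"
proof (cases "radical t \<subseteq> {\<zero>}")
  case True
  have "\<zero> \<in> radical t" using P_ge_2 t by (simp add: radical_eq nat_pow_zero)
  with True have "radical t = {\<zero>}" by auto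
  then show ?thesis by simp
next
  case False
  then obtain u where u: "u \<in> radical t" "u \<noteq> \<zero>" by auto
  then have uc: "u \<in> carrier R" by (simp add: radical_def)
  define a b where "a = t [^] P" and "b = u [^] (P\<^sup>2)"
  have ab: "a \<in> carrier R" "b \<in> carrier R" using t uc by (auto simp: a_def b_def)
  have rel: "a \<otimes> b \<oplus> t \<otimes> u = \<zero>" using u t by (simp add: radical_eq a_def b_def)
  have "radical t = (\<lambda>y. u \<otimes> y) ` {y \<in> carrier R. y [^] (P\<^sup>2) = y}"
  proof -
    have iff: "u \<otimes> y \<in> radical t \<longleftrightarrow> y [^] (P\<^sup>2) = y" if y: "y \<in> carrier R" for y
    proof -
      define c where "c = y [^] (P\<^sup>2)"
      have c: "c \<in> carrier R" using y by (simp add: c_def)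
      have "a \<otimes> (u \<otimes> y) [^] (P\<^sup>2) \<oplus> t \<otimes> (u \<otimes> y) = (a \<otimes> b \<oplus> t \<otimes> u) \<otimes> c \<oplus> t \<otimes> u \<otimes> (y \<ominus> c)"
        unfolding b_def using ab t uc y c
        by (simp add: nat_pow_distrib b_def[symmetric] c_def[symmetric]) algebra
      also have "\<dots> = t \<otimes> u \<otimes> (y \<ominus> c)" unfolding rel using t uc y c by simp
      also have "\<dots> = \<zero> \<longleftrightarrow> c = y"
        using t u uc y c integral[of "t \<otimes> u" "y \<ominus> c"] integral[of t u] by (auto simp: r_neg minus_eq[of y y])
      finally show ?thesis unfolding radical_eq[OF t(1)] c_def[symmetric] using uc y by (simp add: a_def)
    qed
    have "z \<in> (\<lambda>y. u \<otimes> y) ` carrier R" if "z \<in> radical t" for z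
      using mult_bij[OF uc u(2)] that by (auto simp: bij_betw_def radical_def)
    then show ?thesis using iff by auto
  qed
  then have "card (radical t) = card {y \<in> carrier R. y [^] (P\<^sup>2) = y}"
    using inj_on_subset[of "\<lambda>y. u \<otimes> y" "carrier R"] mult_bij[OF uc u(2)]
    by (simp add: card_image bij_betw_def)
  also have "\<dots> = P\<^sup>2"
  proof (rule card_frobenius_fixed)
    show "2 \<le> P\<^sup>2" using P_ge_2 by (simp add: power2_eq_square) (metis le_trans mult_le_mono1 mult_le_mono one_le_numeral mult_1)
  qed (rule P2_dvd)
  finally show ?thesis by simp
qed

lemma gsum_values:
  assumes t: "t \<in> carrier R" "t \<noteq> \<zero>"
  shows "gsum (P + 1) t = (- of_nat P) ^ k \<or> gsum (P + 1) t = (- of_nat P) ^ (k + 1)"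
proof -
  obtain z :: int where z: "gsum (P + 1) t = 1 + of_nat (P + 1) * of_int z"
    using gsum_integer[OF t(1)] by auto
  define m where "m = 1 + int (P + 1) * z"
  have m: "gsum (P + 1) t = of_int m" unfolding z m_def by simp
  have cong: "int P + 1 dvd m - 1" by (simp add: m_def add.commute)
  have "of_int (m\<^sup>2) = gsum (P + 1) t * cnj (gsum (P + 1) t)" unfolding m by (simp add: power2_eq_square)
  also have "\<dots> = of_nat (p ^ n) * (if \<forall>z\<in>radical t. psi (t \<otimes> z [^] (P + 1)) = 1 then of_nat (card (radical t)) else 0)"
    by (simp only: gsum_norm[OF t(1)] sum_radical[OF t(1)])
  also have "\<dots> = of_int (int (P ^ (2 * k)) * (if \<forall>z\<in>radical t. psi (t \<otimes> z [^] (P + 1)) = 1 then int (card (radical t)) else 0))"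
    by (simp add: card_eq_P)
  finally have msq: "m\<^sup>2 = int (P ^ (2 * k)) * (if \<forall>z\<in>radical t. psi (t \<otimes> z [^] (P + 1)) = 1 then int (card (radical t)) else 0)"
    by (simp only: of_int_eq_iff)
  \<comment> \<open>Being 1 modulo \<open>P + 1\<close>, \<open>m\<close> is nonzero, which forces
    the character to be trivial on the radical.\<close>
  have "m \<noteq> 0"
  proof
    assume "m = 0"
    then have "int (P + 1) dvd 1" unfolding m_def by (metis add.commute dvd_add_right_iff dvd_triv_left dvd_0_right)
    then show False using P_ge_2 by simp
  qed
  then have "m\<^sup>2 = int (P ^ (2 * k)) * int (card (radical t))" using msq by (auto split: if_splits)
  then have "m\<^sup>2 = int P ^ (2 * k) \<or> m\<^sup>2 = int P ^ (2 * (k + 1))"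
    using card_radical[OF t] by (auto simp: power_add power2_eq_square)
  then have "m = (- int P) ^ k \<or> m = (- int P) ^ (k + 1)"
    using int_eq_minus_power[OF P_ge_2 _ cong] by blast
  then show ?thesis unfolding m by auto
qed

section \<open>The exceptional coset and the passage to divisors of \<open>P + 1\<close>\<close>

abbreviation v :: complex where "v \<equiv> (- of_nat P) ^ k"

lemma v_nonzero: "v \<noteq> 0" using P_ge_2 by simp

definition special :: "nat \<Rightarrow> bool" where
  "special i \<longleftrightarrow> gsum (P + 1) (gen [^] i) = (- of_nat P) ^ (k + 1)"

text \<open>Since \<open>(- P) ^ (k + 1) = v - (P + 1) * v\<close>, both values fit one formula
  affine in the indicator, which makes summation over cosets linear.\<close>

lemma gsum_special: "gsum (P + 1) (gen [^] i) = v - of_nat (P + 1) * v * of_bool (special i)"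
  using gsum_values[of "gen [^] i"] by (auto simp: special_def algebra_simps)

lemma special_mod: "special (i mod (P + 1)) = special i"
proof -
  have "gsum (P + 1) (gen [^] (i + m * (P + 1))) = gsum (P + 1) (gen [^] i)" for i m
  proof (induction m)
    case (Suc m)
    then show ?case using gsum_gen_periodic[of "P + 1" "i + m * (P + 1)"] by (simp add: algebra_simps)
  qed simp
  from this[of "i mod (P + 1)" "i div (P + 1)"] show ?thesis
    unfolding special_def by (metis mod_mult_div_eq mult.commute)
qed

text \<open>If \<open>c\<close> residues modulo \<open>P + 1\<close> are special, the sum over one
  period is \<open>(P + 1) * v * (1 - c)\<close>. It vanishes by \<open>sum_gsum\<close>, so
  \<open>c = 1\<close>.\<close>

lemma special_unique: "\<exists>i0. \<forall>i. special i \<longleftrightarrow> i mod (P + 1) = i0"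
proof -
  define c where "c = card {i. i < P + 1 \<and> special i}"
  have "0 = (\<Sum>i<(N div (P + 1)) * (P + 1). gsum (P + 1) (gen [^] i))"
    using sum_gsum[of "P + 1"] by (simp only: dvd_div_mult_self[OF Suc_P_dvd] add_gr_0 zero_less_one simp_thms)
  also have "\<dots> = of_nat (N div (P + 1)) * (\<Sum>i<P + 1. gsum (P + 1) (gen [^] i))"
    by (rule sum_lessThan_periodic) (rule gsum_gen_periodic)
  finally have "(\<Sum>i<P + 1. gsum (P + 1) (gen [^] i)) = 0"
    using Suc_P_dvd N_pos by (simp add: dvd_div_eq_0_iff del: sum.lessThan_Suc)
  moreover have "(\<Sum>i<P + 1. gsum (P + 1) (gen [^] i)) =
      of_nat (P + 1) * v - of_nat (P + 1) * v * (\<Sum>i<P + 1. of_bool (special i))"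
    unfolding gsum_special sum_subtractf by (simp only: sum_distrib_left[symmetric]) simp
  moreover have "(\<Sum>i<P + 1. of_bool (special i)) = (of_nat c :: complex)"
    unfolding c_def by (simp add: Int_def lessThan_def del: sum.lessThan_Suc)
  ultimately have "of_nat (P + 1) * v * (1 - of_nat c) = 0" by (simp only: right_diff_distrib mult_1_right)
  moreover have "of_nat (P + 1) \<noteq> (0 :: complex)" unfolding of_nat_eq_0_iff by simp
  ultimately have "of_nat c = (1 :: complex)" using v_nonzero P_ge_2 by auto
  then have "c = 1" by (metis of_nat_eq_1_iff)
  then obtain i0 where i0: "{i. i < P + 1 \<and> special i} = {i0}"
    unfolding c_def by (auto simp: card_1_singleton_iff)
  have "special i \<longleftrightarrow> i mod (P + 1) = i0" for i
  proof -
    have "special i \<longleftrightarrow> i mod (P + 1) \<in> {i. i < P + 1 \<and> special i}"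
      by (simp only: mem_Collect_eq special_mod mod_less_divisor add_gr_0 zero_less_one simp_thms)
    then show ?thesis unfolding i0 by simp
  qed
  then show ?thesis by blast
qed

text \<open>The nonzero \<open>d\<close>-th powers form the union of \<open>(P + 1) div d\<close>
  cosets of the \<open>(P + 1)\<close>-st powers. The outer factors are the multiplicities of the
  two power maps, cross-multiplied to avoid division.\<close>

lemma gsum_reduce:
  assumes "d dvd P + 1" "t \<in> carrier R"
  shows "of_nat (P + 1) * (gsum d t - 1) =
    of_nat d * (\<Sum>a<(P + 1) div d. gsum (P + 1) (t \<otimes> gen [^] (d * a)) - 1)"
proof -
  define e where "e = (P + 1) div d"
  have de: "P + 1 = d * e" using assms by (simp add: e_def)
  have d: "d > 0" and e: "e > 0" using de by (auto intro: Nat.gr0I)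
  obtain M where M: "N = (P + 1) * M" using Suc_P_dvd by auto
  have dN: "d dvd N" unfolding M de by simp
  have Nd: "N div d = M * e" unfolding M de using d by (simp add: mult_ac)
  have NP: "N div (P + 1) = M" unfolding M by (rule nonzero_mult_div_cancel_left) simp
  have "(\<Sum>i<N div d. psi (t \<otimes> gen [^] (d * i))) = (\<Sum>a<e. \<Sum>m<M. psi (t \<otimes> gen [^] (d * (a + m * e))))"
    unfolding Nd by (rule sum_lessThan_mult)
  also have "\<dots> = (\<Sum>a<e. \<Sum>m<M. psi ((t \<otimes> gen [^] (d * a)) \<otimes> gen [^] ((P + 1) * m)))"
  proof (intro sum.cong refl)
    fix a m
    have "d * (a + m * e) = d * a + (P + 1) * m" unfolding de by (simp add: algebra_simps)
    then show "psi (t \<otimes> gen [^] (d * (a + m * e))) = psi ((t \<otimes> gen [^] (d * a)) \<otimes> gen [^] ((P + 1) * m))"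
      using assms by (simp only: nat_pow_mult[symmetric] gen_closed m_assoc nat_pow_closed)
  qed
  finally have 1: "gsum d t - 1 = of_nat d *
      (\<Sum>a<e. \<Sum>m<M. psi ((t \<otimes> gen [^] (d * a)) \<otimes> gen [^] ((P + 1) * m)))"
    using gsum_eq[OF dN assms(2)] by simp
  have 2: "gsum (P + 1) (t \<otimes> gen [^] (d * a)) - 1 =
     of_nat (P + 1) * (\<Sum>m<M. psi ((t \<otimes> gen [^] (d * a)) \<otimes> gen [^] ((P + 1) * m)))" for a
    using gsum_eq[OF Suc_P_dvd, of "t \<otimes> gen [^] (d * a)"] assms unfolding NP by simp
  show ?thesis unfolding 1 2 e_def[symmetric] sum_distrib_left[symmetric] by simp
qed

lemma gsum_two_valued:
  fixes i :: nat
  assumes d: "d dvd P + 1"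
  shows "\<exists>c::bool. gsum d (gen [^] i) = v - of_nat d * v * of_bool c"
proof -
  define e where "e = (P + 1) div d"
  have de: "P + 1 = d * e" using d by (simp add: e_def)
  have d0: "d > 0" using de by (auto intro: Nat.gr0I)
  obtain i0 where i0: "\<And>i. special i \<longleftrightarrow> i mod (P + 1) = i0" using special_unique by auto
  define A where "A = {a. a < e \<and> special (i + d * a)}"
  \<comment> \<open>For \<open>a < e\<close> the exponents \<open>i + d * a\<close> are distinct
    modulo \<open>P + 1 = d * e\<close>, so at most one of them hits the special residue.\<close>
  have "a = b" if "a \<in> A" "b \<in> A" for a b
    using that
  proof (induction a b rule: linorder_wlog)
    case (le a b)
    then have "(i + d * b) mod (P + 1) = (i + d * a) mod (P + 1)" by (simp add: A_def i0 del: Suc_eq_plus1)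
    then have "P + 1 dvd (i + d * b) - (i + d * a)" using le by (intro mod_eq_dvd_iff_nat[THEN iffD1]) auto
    then have "d * e dvd d * (b - a)" unfolding de by (simp add: diff_mult_distrib2)
    then have "e dvd b - a" using d0 by simp
    moreover have "b - a < e" using le by (auto simp: A_def)
    ultimately show "a = b" using le by (metis diff_is_0_eq dvd_imp_le le_antisym not_less zero_less_iff_neq_zero)
  qed metis
  then have "card A \<le> 1" by (auto simp: card_le_Suc0_iff_eq A_def)
  then have cA: "card A = of_bool (card A = 1)" by (cases "card A") auto
  have "of_nat (P + 1) * (gsum d (gen [^] i) - 1) = of_nat d * (\<Sum>a<e. gsum (P + 1) (gen [^] (i + d * a)) - 1)"
    using gsum_reduce[OF d, of "gen [^] i"] by (simp add: nat_pow_mult e_def)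
  also have "(\<Sum>a<e. gsum (P + 1) (gen [^] (i + d * a)) - 1) =
     of_nat e * (v - 1) - of_nat (P + 1) * v * (\<Sum>a<e. of_bool (special (i + d * a)))"
    unfolding gsum_special by (simp add: sum_subtractf sum_distrib_left right_diff_distrib)
  also have "(\<Sum>a<e. of_bool (special (i + d * a))) = (of_nat (card A) :: complex)"
    unfolding A_def by (simp add: Int_def)
  also have "of_nat d * (of_nat e * (v - 1) - of_nat (P + 1) * v * of_nat (card A)) =
      of_nat (P + 1) * ((v - 1) - of_nat d * v * of_nat (card A))"
    unfolding de by (simp add: algebra_simps)
  finally have "gsum d (gen [^] i) - 1 = (v - 1) - of_nat d * v * of_nat (card A)"
    by (metis mult_left_cancel of_nat_eq_0_iff Suc_eq_plus1 nat.distinct(1))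
  then have "gsum d (gen [^] i) = v - of_nat d * v * of_bool (card A = 1)"
    by (subst (asm) cA) (simp add: algebra_simps)
  then show ?thesis by blast
qed

lemma sum_gsum_power:
  assumes d: "d dvd P + 1"
  shows "of_nat d * (\<Sum>i<N. gsum d (gen [^] i) ^ m) =
    of_nat N * (v ^ m * ((of_nat d - 1) + (1 - of_nat d) ^ m))"
proof -
  have d0: "d > 0" using d by (auto intro: Nat.gr0I)
  have dN: "d dvd N" using d Suc_P_dvd by (rule dvd_trans)
  obtain M where M: "N = M * d" using dN by (metis dvd_def mult.commute)
  obtain c :: "nat \<Rightarrow> bool" where c: "\<And>i. gsum d (gen [^] i) = v - of_nat d * v * of_bool (c i)"
    using choice[of "\<lambda>i c. gsum d (gen [^] i) = v - of_nat d * v * of_bool c"] gsum_two_valued[OF d] by auto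
  have per: "(\<Sum>i<N. gsum d (gen [^] i) ^ m) = of_nat M * (\<Sum>i<d. gsum d (gen [^] i) ^ m)" for m
    unfolding M by (rule sum_lessThan_periodic) (simp add: gsum_gen_periodic)
  have "(\<Sum>i<d. gsum d (gen [^] i)) = 0"
    using per[of 1] sum_gsum[OF d0] N_pos M by auto
  moreover have "(\<Sum>i<d. gsum d (gen [^] i)) = of_nat d * v * (1 - (\<Sum>i<d. of_bool (c i)))"
    unfolding c by (simp add: sum_subtractf sum_distrib_left right_diff_distrib)
  \<comment> \<open>The vanishing total forces exactly one of the \<open>d\<close> cosets to carry
    the value \<open>(1 - d) * v\<close>.\<close>
  ultimately have sc: "(\<Sum>i<d. of_bool (c i)) = (1 :: complex)" using d0 v_nonzero by auto
  have pw: "gsum d (gen [^] i) ^ m = v ^ m + v ^ m * ((1 - of_nat d) ^ m - 1) * of_bool (c i)" for i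
  proof (cases "c i")
    case True
    then have *: "gsum d (gen [^] i) = v * (1 - of_nat d)" by (simp add: c algebra_simps)
    show ?thesis unfolding * power_mult_distrib using True by (simp add: algebra_simps)
  qed (simp add: c)
  have "(\<Sum>i<d. gsum d (gen [^] i) ^ m) = of_nat d * v ^ m + v ^ m * ((1 - of_nat d) ^ m - 1) * (\<Sum>i<d. of_bool (c i))"
    unfolding pw by (simp add: sum.distrib sum_distrib_left)
  also have "\<dots> = v ^ m * ((of_nat d - 1) + (1 - of_nat d) ^ m)"
    unfolding sc by (simp add: algebra_simps)
  finally show ?thesis unfolding per by (simp add: M)
qed

end

subsection \<open>Counting points\<close>

text \<open>Distributivity, one list entry at a time. It turns a character sum over tuples into a
  power of a one-variable sum.\<close>

lemma sum_lists_prod: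
  fixes g :: "'a \<Rightarrow> 'c :: comm_semiring_1"
  shows "(\<Sum>xs | set xs \<subseteq> A \<and> length xs = m. \<Prod>i<m. g (xs ! i)) = (\<Sum>x\<in>A. g x) ^ m"
proof (induction m)
  case 0
  have "{xs. set xs \<subseteq> A \<and> xs = []} = {[]}" by auto
  then show ?case by simp
next
  case (Suc m)
  have "(\<Sum>xs | set xs \<subseteq> A \<and> length xs = Suc m. \<Prod>i<Suc m. g (xs ! i)) =
     (\<Sum>(xs, x)\<in>{xs. set xs \<subseteq> A \<and> length xs = m} \<times> A. g x * (\<Prod>i<m. g (xs ! i)))"
    unfolding lists_length_Suc_eq
    by (subst sum.reindex) (auto simp: inj_on_def prod.lessThan_Suc_shift case_prod_unfold simp del: prod.lessThan_Suc)
  also have "\<dots> = (\<Sum>xs | set xs \<subseteq> A \<and> length xs = m. \<Sum>x\<in>A. g x * (\<Prod>i<m. g (xs ! i)))"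
    by (rule sum.cartesian_product[symmetric])
  also have "\<dots> = (\<Sum>x\<in>A. g x) * (\<Sum>xs | set xs \<subseteq> A \<and> length xs = m. \<Prod>i<m. g (xs ! i))"
    by (simp add: sum_distrib_left[symmetric] sum_distrib_right[symmetric])
  finally show ?case using Suc by simp
qed

text \<open>Neither \<open>div\<close> nor \<open>nat\<close> loses anything in \<open>B\<close>:
  \<open>d - 1\<close> is minus one modulo \<open>d\<close>, so the division is exact, and for
  \<open>m > 0\<close> the first term dominates the second, so the quotient is not negative.\<close>

lemma B_eq:
  assumes "d > 0" "m > 0"
  shows "int d * int (B d m) = (int d - 1) ^ m + (-1) ^ m * (int d - 1)"
proof -
  let ?x = "(int d - 1) ^ m + (-1) ^ m * (int d - 1)"
  have "int d dvd (int d - 1) ^ m - (-1) ^ m"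
    using power_diff_sumr2[of "int d - 1" m "- 1"] by simp
  then have "int d dvd ((int d - 1) ^ m - (-1) ^ m) + (-1) ^ m * int d" by (rule dvd_add) simp
  also have "((int d - 1) ^ m - (-1) ^ m) + (-1) ^ m * int d = ?x" by (simp add: algebra_simps)
  finally have dvd: "int d dvd ?x" .
  have "(int d - 1) ^ m \<ge> int d - 1"
  proof (cases "d = 1")
    case False
    then show ?thesis using assms by (intro self_le_power) auto
  qed (use assms in simp)
  moreover have "(-1) ^ m * (int d - 1) \<ge> - (int d - 1)"
    using assms by (cases "even m") auto
  ultimately have "?x \<ge> 0" by linarith
  then have "?x div int d \<ge> 0" using assms by (simp add: pos_imp_zdiv_nonneg_iff)
  then show ?thesis using dvd by (simp add: B_def)
qed

definition (in ring) power_form :: "nat \<Rightarrow> nat \<Rightarrow> 'a list \<Rightarrow> 'a" where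
  "power_form d s xs = (\<Oplus>i\<in>{..s}. xs ! i [^] d)"

context finite_field
begin

lemma nth_carrier:
  "set xs \<subseteq> carrier R \<Longrightarrow> length xs = Suc s \<Longrightarrow> i \<le> s \<Longrightarrow> xs ! i \<in> carrier R"
  by (metis le_imp_less_Suc nth_mem subsetD)

lemma power_form_closed:
  "set xs \<subseteq> carrier R \<Longrightarrow> length xs = Suc s \<Longrightarrow> power_form d s xs \<in> carrier R"
  unfolding power_form_def by (rule finsum_closed) (auto intro!: nat_pow_closed nth_carrier)

lemma psi_finsum:
  assumes "finite I" "f \<in> I \<rightarrow> carrier R" "t \<in> carrier R"
  shows "psi (t \<otimes> finsum R f I) = (\<Prod>i\<in>I. psi (t \<otimes> f i))"
  using assms(1,2)
proof (induction I rule: finite_induct)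
  case (insert i I)
  then have "f i \<in> carrier R" "finsum R f I \<in> carrier R" by (auto intro!: finsum_closed)
  then have "psi (t \<otimes> finsum R f (insert i I)) = psi (t \<otimes> f i) * psi (t \<otimes> finsum R f I)"
    using insert assms(3) by (subst finsum_insert) (auto simp: r_distr psi_add)
  then show ?case using insert by auto
qed (use assms(3) in simp)

text \<open>Orthogonality in \<open>t\<close> detects the zeros of the form, and for fixed
  \<open>t\<close> the sum over tuples factors. The first summand is the contribution of
  \<open>t = \<zero>\<close>.\<close>

lemma affine_count:
  "of_nat (p ^ n) * of_nat (card {xs. set xs \<subseteq> carrier R \<and> length xs = Suc s \<and> power_form d s xs = \<zero>}) =
    of_nat (p ^ n) ^ Suc s + (\<Sum>i<N. gsum d (gen [^] i) ^ Suc s)"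
proof -
  define V where "V = {xs. set xs \<subseteq> carrier R \<and> length xs = Suc s}"
  have V: "finite V" unfolding V_def by (rule finite_lists_length_eq) simp
  have nth: "xs ! i \<in> carrier R" if "xs \<in> V" "i \<le> s" for xs i
    using that nth_carrier by (auto simp: V_def)
  have pf: "power_form d s xs \<in> carrier R" if "xs \<in> V" for xs
    using that by (auto simp: V_def intro: power_form_closed)
  have "{xs. set xs \<subseteq> carrier R \<and> length xs = Suc s \<and> power_form d s xs = \<zero>} = {xs\<in>V. power_form d s xs = \<zero>}"
    by (auto simp: V_def)
  then have "of_nat (p ^ n) * of_nat (card {xs. set xs \<subseteq> carrier R \<and> length xs = Suc s \<and> power_form d s xs = \<zero>}) =
     (\<Sum>xs\<in>{xs\<in>V. power_form d s xs = \<zero>}. complex_of_nat (p ^ n))"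
    by (simp add: mult.commute)
  also have "\<dots> = (\<Sum>xs\<in>V. if power_form d s xs = \<zero> then of_nat (p ^ n) else 0)"
    by (rule sum.inter_filter) (rule V)
  also have "\<dots> = (\<Sum>xs\<in>V. \<Sum>t\<in>carrier R. psi (power_form d s xs \<otimes> t))"
    by (intro sum.cong refl) (simp add: sum_psi pf)
  also have "\<dots> = (\<Sum>t\<in>carrier R. \<Sum>xs\<in>V. psi (power_form d s xs \<otimes> t))"
    by (rule sum.swap)
  also have "\<dots> = (\<Sum>t\<in>carrier R. gsum d t ^ Suc s)"
  proof (rule sum.cong[OF refl])
    fix t assume t: "t \<in> carrier R"
    have "psi (power_form d s xs \<otimes> t) = (\<Prod>i<Suc s. psi (t \<otimes> (xs ! i) [^] d))" if "xs \<in> V" for xs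
    proof -
      have "psi (power_form d s xs \<otimes> t) = psi (t \<otimes> power_form d s xs)" using t pf[OF that] by (simp add: m_comm)
      also have "\<dots> = (\<Prod>i\<in>{..s}. psi (t \<otimes> (xs ! i) [^] d))"
        unfolding power_form_def by (rule psi_finsum) (use nth that t in auto)
      finally show ?thesis by (simp only: lessThan_Suc_atMost)
    qed
    then have "(\<Sum>xs\<in>V. psi (power_form d s xs \<otimes> t)) = (\<Sum>xs\<in>V. \<Prod>i<Suc s. psi (t \<otimes> (xs ! i) [^] d))"
      by (intro sum.cong refl)
    also have "\<dots> = gsum d t ^ Suc s"
      unfolding V_def gsum_def by (rule sum_lists_prod)
    finally show "(\<Sum>xs\<in>V. psi (power_form d s xs \<otimes> t)) = gsum d t ^ Suc s" .
  qed
  also have "\<dots> = of_nat (p ^ n) ^ Suc s + (\<Sum>i<N. gsum d (gen [^] i) ^ Suc s)"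
    unfolding sum_carrier gsum_zero ..
  finally show ?thesis .
qed

section \<open>From affine zeros to projective points\<close>

lemma power_form_scale:
  assumes "c \<in> carrier R" "set xs \<subseteq> carrier R" "length xs = Suc s"
  shows "power_form d s (map (\<lambda>x. c \<otimes> x) xs) = c [^] d \<otimes> power_form d s xs"
proof -
  have nth: "xs ! i \<in> carrier R" if "i \<le> s" for i
    using assms that nth_carrier by auto
  have "power_form d s (map (\<lambda>x. c \<otimes> x) xs) = (\<Oplus>i\<in>{..s}. c [^] d \<otimes> xs ! i [^] d)"
    unfolding power_form_def by (rule finsum_cong') (use assms nth in \<open>auto simp: nat_pow_distrib\<close>)
  also have "\<dots> = c [^] d \<otimes> power_form d s xs"
    unfolding power_form_def by (rule finsum_rdistr[symmetric]) (use assms nth in auto)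
  finally show ?thesis .
qed

lemma scale_scale:
  "c \<in> carrier R \<Longrightarrow> b \<in> carrier R \<Longrightarrow> set xs \<subseteq> carrier R \<Longrightarrow>
    map (\<lambda>x. c \<otimes> x) (map (\<lambda>x. b \<otimes> x) xs) = map (\<lambda>x. (c \<otimes> b) \<otimes> x) xs"
  by (auto simp: m_assoc)

lemma scale_one: "set xs \<subseteq> carrier R \<Longrightarrow> map (\<lambda>x. \<one> \<otimes> x) xs = xs"
  by (rule map_idI) auto

lemma scale_nonzero_tuples:
  assumes "c \<in> carrier R - {\<zero>}" "xs \<in> nonzero_tuples R s"
  shows "map (\<lambda>x. c \<otimes> x) xs \<in> nonzero_tuples R s"
  using assms integral[of c] by (fastforce simp: nonzero_tuples_def)

lemma inv_nonzero: "c \<in> carrier R - {\<zero>} \<Longrightarrow> inv c \<in> carrier R - {\<zero>}"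
  using Units_inv_Units[of c] field_Units by auto

lemma equiv_proj_rel: "equiv (nonzero_tuples R s) (proj_rel R s)"
proof (rule equivI)
  show "proj_rel R s \<subseteq> nonzero_tuples R s \<times> nonzero_tuples R s" by (auto simp: proj_rel_def)
  show "refl_on (nonzero_tuples R s) (proj_rel R s)"
    by (rule refl_onI) (auto simp: proj_rel_def nonzero_tuples_def scale_one intro!: bexI[of _ \<one>])
  show "sym (proj_rel R s)"
  proof (rule symI)
    fix u w assume "(u, w) \<in> proj_rel R s"
    then obtain c where c: "c \<in> carrier R - {\<zero>}" "u = map (\<lambda>x. c \<otimes> x) w"
      and uw: "u \<in> nonzero_tuples R s" "w \<in> nonzero_tuples R s" by (auto simp: proj_rel_def)
    have "inv c \<otimes> c = \<one>" using c field_Units by auto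
    then have "w = map (\<lambda>x. inv c \<otimes> x) u"
      using c inv_nonzero[OF c(1)] uw scale_scale[of "inv c" c w]
      by (simp add: nonzero_tuples_def scale_one)
    then show "(w, u) \<in> proj_rel R s" using uw inv_nonzero[OF c(1)] by (auto simp: proj_rel_def)
  qed
  show "trans (proj_rel R s)"
  proof (rule transI)
    fix u w z assume "(u, w) \<in> proj_rel R s" "(w, z) \<in> proj_rel R s"
    then obtain b c where c: "c \<in> carrier R - {\<zero>}" "u = map (\<lambda>x. c \<otimes> x) w"
      "b \<in> carrier R - {\<zero>}" "w = map (\<lambda>x. b \<otimes> x) z"
      and uz: "u \<in> nonzero_tuples R s" "z \<in> nonzero_tuples R s"
      unfolding proj_rel_def by blast
    then have "u = map (\<lambda>x. (c \<otimes> b) \<otimes> x) z" "c \<otimes> b \<in> carrier R - {\<zero>}"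
      using scale_scale[of c b z] integral[of c b] by (auto simp: nonzero_tuples_def)
    then show "(u, z) \<in> proj_rel R s" using uz unfolding proj_rel_def by blast
  qed
qed

text \<open>\<open>proj_rel\<close> scales its second component, so symmetry is used to see the
  class of \<open>u\<close> as the set of multiples of \<open>u\<close>.\<close>

lemma proj_class_eq:
  assumes u: "u \<in> nonzero_tuples R s"
  shows "proj_rel R s `` {u} = (\<lambda>c. map (\<lambda>x. c \<otimes> x) u) ` (carrier R - {\<zero>})"
proof -
  have "proj_rel R s `` {u} = {w. (w, u) \<in> proj_rel R s}"
    using equiv_proj_rel[of s] by (auto simp: equiv_def dest: symD)
  then show ?thesis using u scale_nonzero_tuples[OF _ u] by (auto simp: proj_rel_def)
qed

text \<open>A nonzero coordinate makes scaling injective in the scalar.\<close>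

lemma card_proj_class:
  assumes "X \<in> proj_space R s"
  shows "card X = N"
proof -
  obtain u where u: "u \<in> nonzero_tuples R s" "X = proj_rel R s `` {u}"
    using assms by (auto simp: proj_space_def elim: quotientE)
  then obtain x where x: "x \<in> set u" "x \<noteq> \<zero>" "x \<in> carrier R" by (auto simp: nonzero_tuples_def)
  have "inj_on (\<lambda>c. map (\<lambda>x. c \<otimes> x) u) (carrier R - {\<zero>})"
    using x by (intro inj_onI) (auto simp: m_rcancel)
  then show ?thesis unfolding u(2) proj_class_eq[OF u(1)] by (simp add: card_image card_nonzero)
qed

text \<open>The nonzero affine zeros are partitioned into projective classes of \<open>N\<close>
  tuples each. The extra one is the zero tuple, a zero of the form because
  \<open>d > 0\<close>.\<close>

lemma projective_count:
  assumes "d > 0"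
  shows "N * fermat_count R d s + 1 =
    card {xs. set xs \<subseteq> carrier R \<and> length xs = Suc s \<and> power_form d s xs = \<zero>}"
proof -
  define C where "C = {X \<in> proj_space R s. \<forall>w\<in>X. power_form d s w = \<zero>}"
  define A where "A = {xs. set xs \<subseteq> carrier R \<and> length xs = Suc s \<and> power_form d s xs = \<zero>}"
  define z where "z = replicate (Suc s) \<zero>"
  have eq: "equiv (nonzero_tuples R s) (proj_rel R s)" by (rule equiv_proj_rel)
  have finA: "finite A"
    by (rule finite_subset[OF _ finite_lists_length_eq[OF finite_carrier, of "Suc s"]]) (auto simp: A_def)
  have z: "z \<in> A"
    using assms unfolding A_def z_def power_form_def
    by (auto simp: nat_pow_zero intro!: add.finprod_one_eqI simp del: replicate_Suc)
  have nz: "A - {z} = {xs \<in> nonzero_tuples R s. power_form d s xs = \<zero>}"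
    unfolding A_def z_def nonzero_tuples_def by (auto simp: replicate_length_same simp del: replicate_Suc) (metis replicate_length_same)
  have UC: "\<Union>C = A - {z}"
  proof
    show "\<Union>C \<subseteq> A - {z}"
      unfolding nz C_def proj_space_def using Union_quotient[OF eq] by auto
    show "A - {z} \<subseteq> \<Union>C"
    proof
      fix u assume "u \<in> A - {z}"
      then have u: "u \<in> nonzero_tuples R s" "power_form d s u = \<zero>" unfolding nz by auto
      have uc: "set u \<subseteq> carrier R" "length u = Suc s" using u by (auto simp: nonzero_tuples_def)
      have "power_form d s w = \<zero>" if "w \<in> proj_rel R s `` {u}" for w
        using that uc u(2) unfolding proj_class_eq[OF u(1)] by (auto simp: power_form_scale)
      then have "proj_rel R s `` {u} \<in> C"
        using u by (auto simp: C_def proj_space_def intro: quotientI)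
      then show "u \<in> \<Union>C" using equiv_class_self[OF eq u(1)] by auto
    qed
  qed
  have finUC: "finite (\<Union>C)" unfolding UC using finA by simp
  have "N * card C = card (\<Union>C)"
  proof (rule card_partition)
    show "finite C" using finUC by (rule finite_UnionD)
    show "card c = N" if "c \<in> C" for c using that card_proj_class by (auto simp: C_def)
    show "c1 \<inter> c2 = {}" if "c1 \<in> C" "c2 \<in> C" "c1 \<noteq> c2" for c1 c2
      using that quotient_disj[OF eq, of c1 c2] by (auto simp: C_def proj_space_def)
  qed (rule finUC)
  moreover have "fermat_count R d s = card C"
    by (simp add: fermat_count_def C_def power_form_def)
  ultimately show ?thesis
    unfolding A_def[symmetric] UC using finA z by (simp add: card_Diff_singleton card_gt_0_iff Suc_diff_1)
      (metis Suc_pred card_gt_0_iff empty_iff)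
qed

end

text \<open>With \<open>q = P\<^sup>2\<close>, the factor \<open>P ^ (k * (s - 1))\<close> is the
  integral form of q to the power k(s-1)/2.\<close>

lemma (in square_field) fermat_count_eq:
  assumes d: "d dvd P + 1" and s: "s > 0"
  shows "real (fermat_count R d s) = (real (p ^ n) ^ s - 1) / (real (p ^ n) - 1) +
    (-1) ^ ((k + 1) * (s + 1)) * real P ^ (k * (s - 1)) * real (B d (s + 1))"
proof -
  have d0: "d > 0" using d by (auto intro: Nat.gr0I)
  define Q where "Q = p ^ n"
  define \<epsilon> :: int where "\<epsilon> = (-1) ^ ((k + 1) * (s + 1))"
  define b where "b = int (B d (s + 1))"
  define A where "A = card {xs. set xs \<subseteq> carrier R \<and> length xs = Suc s \<and> power_form d s xs = \<zero>}"
  have N: "int N = int Q - 1" using Suc_N unfolding Q_def by linarith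
  have Q: "int Q = int P ^ (2 * k)" by (simp add: Q_def card_eq_P)
  have B: "int d * b = (int d - 1) ^ Suc s + (-1) ^ Suc s * (int d - 1)"
    using B_eq[OF d0, of "s + 1"] by (simp add: b_def)
  \<comment> \<open>One sign comes from \<open>v\<close>, the other from writing
    \<open>1 - d\<close> as \<open>- (d - 1)\<close> so that the numerator of \<open>B\<close>
    appears.\<close>
  have sgn: "((- int P) ^ k) ^ Suc s * (-1) ^ Suc s = \<epsilon> * int P ^ (k * Suc s)"
  proof -
    have "((- int P) ^ k) ^ Suc s * (-1) ^ Suc s = ((-1) ^ (k + 1) * int P ^ k) ^ Suc s"
    proof -
      have "(- int P) ^ k * (-1) = (-1) ^ (k + 1) * int P ^ k" by (subst power_minus) simp
      then show ?thesis by (simp only: power_mult_distrib[symmetric])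
    qed
    also have "\<dots> = \<epsilon> * int P ^ (k * Suc s)"
      by (simp only: power_mult_distrib power_mult[symmetric] \<epsilon>_def Suc_eq_plus1)
    finally show ?thesis .
  qed
  \<comment> \<open>Splits off the factor \<open>Q\<close> that is later cancelled against the one
    in front of the affine count.\<close>
  have PP: "int P ^ (k * Suc s) = int Q * int P ^ (k * (s - 1))"
  proof -
    have "k * Suc s = 2 * k + k * (s - 1)" using s by (cases s) auto
    then show ?thesis by (simp only: Q power_add)
  qed
  have "of_nat d * (of_nat Q * of_nat A) = of_nat d * of_nat Q ^ Suc s +
     of_nat N * (v ^ Suc s * ((of_nat d - 1) + (1 - of_nat d) ^ Suc s))"
    unfolding sum_gsum_power[OF d, symmetric] A_def Q_def affine_count by (simp add: algebra_simps)
  \<comment> \<open>The complex identity has integer entries; back in the integers, \<open>d\<close>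
    and \<open>Q\<close> can be cancelled.\<close>
  then have "of_int (int d * (int Q * int A)) = (of_int (int d * int Q ^ Suc s +
     int N * (((- int P) ^ k) ^ Suc s * ((int d - 1) + (1 - int d) ^ Suc s))) :: complex)"
    by simp
  then have "int d * (int Q * int A) = int d * int Q ^ Suc s +
     int N * (((- int P) ^ k) ^ Suc s * ((int d - 1) + (1 - int d) ^ Suc s))"
    by (simp only: of_int_eq_iff)
  also have "(int d - 1) + (1 - int d) ^ Suc s = (-1) ^ Suc s * (int d * b)"
  proof -
    have "(1 - int d) ^ Suc s = (-1) ^ Suc s * (int d - 1) ^ Suc s"
      unfolding power_mult_distrib[symmetric] by simp
    moreover have "((-1) ^ Suc s :: int) * ((-1) ^ Suc s) = 1"
      by (simp flip: power_mult_distrib)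
    ultimately show ?thesis unfolding B by (simp add: distrib_left mult.assoc[symmetric] del: power_Suc)
  qed
  also have "((- int P) ^ k) ^ Suc s * ((-1) ^ Suc s * (int d * b)) = \<epsilon> * (int Q * int P ^ (k * (s - 1))) * (int d * b)"
    by (simp only: mult.assoc[symmetric] sgn PP)
  also have "int d * int Q ^ Suc s + int N * (\<epsilon> * (int Q * int P ^ (k * (s - 1))) * (int d * b)) =
     int d * (int Q * (int Q ^ s + int N * \<epsilon> * int P ^ (k * (s - 1)) * b))"
    by (simp add: algebra_simps)
  finally have "int A = int Q ^ s + int N * \<epsilon> * int P ^ (k * (s - 1)) * b"
    using d0 p_ge_2 by (auto simp: Q_def)
  moreover have "int A = int N * int (fermat_count R d s) + 1"
    using projective_count[OF d0, of s] unfolding A_def by (metis of_nat_1 of_nat_add of_nat_mult)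
  ultimately have "int N * int (fermat_count R d s) = int Q ^ s - 1 + int N * (\<epsilon> * int P ^ (k * (s - 1)) * b)"
    by (simp add: mult.assoc)
  then have "real_of_int (int N * int (fermat_count R d s)) = real_of_int (int Q ^ s - 1 + int N * (\<epsilon> * int P ^ (k * (s - 1)) * b))"
    by simp
  then have "real N * real (fermat_count R d s) = real Q ^ s - 1 + real N * (\<epsilon> * real P ^ (k * (s - 1)) * b)"
    by simp
  then have "real (fermat_count R d s) = (real Q ^ s - 1) / real N + \<epsilon> * real P ^ (k * (s - 1)) * b"
    using N_pos by (simp add: field_simps)
  moreover have "real N = real Q - 1" using N by linarith
  ultimately show ?thesis by (simp add: Q_def \<epsilon>_def b_def)
qed

subsection \<open>The zeta function\<close>

text \<open>\<open>g = exp f\<close>, stated through the logarithmic derivative so that products need no composition.\<close>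
definition log_deriv :: "real fps \<Rightarrow> real fps \<Rightarrow> bool" where
  "log_deriv f g \<longleftrightarrow> fps_nth g 0 = 1 \<and> fps_deriv g = g * fps_deriv f"

lemma log_deriv_add: "log_deriv f g \<Longrightarrow> log_deriv f' g' \<Longrightarrow> log_deriv (f + f') (g * g')"
  by (simp add: log_deriv_def algebra_simps)

lemma log_deriv_zero: "log_deriv 0 1"
  by (simp add: log_deriv_def)

lemma log_deriv_sum: "(\<And>i. i \<in> A \<Longrightarrow> log_deriv (f i) (g i)) \<Longrightarrow> log_deriv (sum f A) (prod g A)"
  by (induction A rule: infinite_finite_induct) (auto intro: log_deriv_add log_deriv_zero)

lemma log_deriv_inverse:
  assumes "log_deriv f g"
  shows "log_deriv (- f) (inverse g)"
proof -
  have g0: "fps_nth g 0 \<noteq> 0" using assms by (simp add: log_deriv_def)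
  have 1: "inverse g * g = 1" using inverse_mult_eq_1[OF g0] .
  have "fps_deriv (inverse g) = - (g * fps_deriv f) * (inverse g)\<^sup>2"
    using assms fps_inverse_deriv[OF g0] by (simp add: log_deriv_def)
  also have "\<dots> = - ((inverse g * g) * inverse g * fps_deriv f)"
    by (simp add: power2_eq_square mult_ac)
  finally show ?thesis using assms unfolding 1 by (simp add: log_deriv_def)
qed

text \<open>The composition also has logarithmic derivative \<open>f'\<close>, by the chain rule, so
  its quotient with \<open>g\<close> has derivative zero and constant term one.\<close>

lemma exp_compose_eq:
  assumes "fps_nth f 0 = 0" "log_deriv f g"
  shows "fps_exp 1 oo f = g"
proof -
  define w where "w = fps_exp 1 oo f"
  have "log_deriv f w"
    using assms(1) by (simp add: log_deriv_def w_def fps_compose_deriv fps_exp_deriv)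
  then have "log_deriv (f + - f) (g * inverse w)"
    by (intro log_deriv_add log_deriv_inverse assms)
  then have "g * inverse w = 1"
    using fps_deriv_eq_0_iff[of "g * inverse w"] by (auto simp: log_deriv_def)
  moreover have "inverse w * w = 1"
    using \<open>log_deriv f w\<close> by (intro inverse_mult_eq_1) (simp add: log_deriv_def)
  ultimately have "g = w" by (metis mult.assoc mult.right_neutral mult_1)
  then show ?thesis by (simp add: w_def)
qed

text \<open>The expansion of -log(1 - aX).\<close>

definition log_series :: "real \<Rightarrow> real fps" where
  "log_series a = Abs_fps (\<lambda>k. if k = 0 then 0 else a ^ k / real k)"

text \<open>The derivative of \<open>log_series a\<close> is a geometric series, which telescopes to
  \<open>a\<close> when multiplied by \<open>1 - aX\<close>.\<close>

lemma log_deriv_linear: "log_deriv (- log_series a) (1 - fps_const a * fps_X)"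
proof -
  have "fps_deriv (log_series a) = Abs_fps (\<lambda>k. a ^ Suc k)"
    by (rule fps_ext) (simp add: log_series_def)
  then have "fps_deriv (log_series a) - fps_const a * (fps_X * fps_deriv (log_series a)) = fps_const a"
    by (intro fps_ext) (auto split: nat.split simp: gr0_conv_Suc)
  then show ?thesis by (simp add: log_deriv_def algebra_simps flip: fps_const_neg)
qed

lemma log_deriv_linear_power:
  "log_deriv (- (of_nat m * log_series a)) ((1 - fps_const a * fps_X) ^ m)"
  using log_deriv_sum[of "{..<m}" "\<lambda>_. - log_series a" "\<lambda>_. 1 - fps_const a * fps_X"]
  by (simp add: log_deriv_linear)

text \<open>Only positive indices are compared, so nothing has to be known about the count at index
  zero.\<close>

lemma zeta_fps_eq:
  assumes "\<And>k. k > 0 \<Longrightarrow> real (M k) / real k = fps_nth f k" "fps_nth f 0 = 0" "log_deriv f g"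
  shows "zeta_fps M = g"
proof -
  have "Abs_fps (\<lambda>k. if k = 0 then 0 else real (M k) / real k) = f"
    by (rule fps_ext) (use assms in auto)
  then show ?thesis unfolding zeta_fps_def using exp_compose_eq assms by auto
qed

theorem theorem3p2:
  fixes p r s d :: nat and q :: nat and F :: "nat \<Rightarrow> ('a, 'b) ring_scheme"
  assumes "prime p" and "r \<ge> 1" and "q = p ^ (2 * r)" and "s \<ge> 1"
    and "d > 0" and "d dvd p ^ r + 1"
    and "\<And>k. k \<ge> 1 \<Longrightarrow> field (F k) \<and> finite (carrier (F k)) \<and> card (carrier (F k)) = q ^ k"
  shows "(zeta_fps (\<lambda>k. fermat_count (F k) d s) =
      (if even s then
         (1 + fps_const (real (p ^ (r * (s - 1)))) * fps_X) ^ B d (s + 1)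
           * inverse (\<Prod>i<s. 1 - fps_const (real q ^ i) * fps_X)
       else
         inverse ((1 - fps_const (real (p ^ (r * (s - 1)))) * fps_X) ^ B d (s + 1)
           * (\<Prod>i<s. 1 - fps_const (real q ^ i) * fps_X))))
    \<and> (\<forall>k\<ge>1. real (fermat_count (F k) d s) =
      (real q ^ (k * s) - 1) / (real q ^ k - 1)
      + (-1) ^ ((k + 1) * (s + 1)) * real p ^ (r * k * (s - 1)) * real (B d (s + 1)))"
proof -
  \<comment> \<open>This is q to the power (s-1)/2, an integer because \<open>q\<close> is the
    square of \<open>p ^ r\<close>.\<close>
  define c where "c = real (p ^ (r * (s - 1)))"
  define b where "b = B d (s + 1)"
  have count: "real (fermat_count (F k) d s) =
      (real q ^ (k * s) - 1) / (real q ^ k - 1)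
      + (-1) ^ ((k + 1) * (s + 1)) * real p ^ (r * k * (s - 1)) * real (B d (s + 1))" if k: "k \<ge> 1" for k
  proof -
    have qk: "q ^ k = p ^ (2 * r * k)" by (simp add: assms(3) power_mult)
    interpret K: square_field "F k" p "2 * r * k" r k
      using assms(1,2) assms(7)[OF k] k
      by (intro square_field.intro finite_field.intro finite_field_axioms.intro square_field_axioms.intro)
        (auto simp: qk)
    show ?thesis
      using K.fermat_count_eq[of d s] assms(4,6)
      by (simp add: K.P_def flip: qk power_mult) (simp add: power_mult[symmetric] mult.assoc)
  qed
  have q: "real q ^ k \<noteq> 1" if "k > 0" for k
  proof -
    have "1 < real q" using assms(1-3) prime_gt_1_nat[of p] by (simp add: one_less_power)
    then have "1 < real q ^ k" using that by (rule one_less_power)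
    then show ?thesis by linarith
  qed
  \<comment> \<open>The point count of projective space of dimension \<open>s - 1\<close>, as a sum
    of \<open>k\<close>-th powers; each of them yields one factor of the denominator.\<close>
  have geometric: "(real q ^ (k * s) - 1) / (real q ^ k - 1) = (\<Sum>i<s. (real q ^ i) ^ k)" if "k > 0" for k
    using geometric_sum[OF q[OF that], of s] by (simp add: power_mult[symmetric] mult.commute)
  have ck: "real p ^ (r * k * (s - 1)) = c ^ k" for k
    by (simp add: c_def power_mult[symmetric] mult_ac)
  have sum: "log_deriv (\<Sum>i<s. - log_series (real q ^ i)) (\<Prod>i<s. 1 - fps_const (real q ^ i) * fps_X)"
    by (intro log_deriv_sum log_deriv_linear)
  have coeff: "real (fermat_count (F k) d s) / real k =
      fps_nth (\<Sum>i<s. log_series (real q ^ i)) k + (if even s then - fps_nth (of_nat b * log_series (- c)) k else fps_nth (of_nat b * log_series c) k)"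
    if k: "k > 0" for k
  proof -
    \<comment> \<open>For odd \<open>s\<close> the exponent is even. For even \<open>s\<close> the
      sign is \<open>(-1) ^ (k + 1)\<close>, which is absorbed into \<open>- ((- c) ^ k)\<close> and
      so moves the factor \<open>1 + cX\<close> to the numerator.\<close>
    have sgn: "(-1) ^ ((k + 1) * (s + 1)) * c ^ k = (if even s then - ((- c) ^ k) else c ^ k)"
      by (auto simp: power_minus[of c] minus_one_power_iff)
    have "real (fermat_count (F k) d s) =
        (\<Sum>i<s. (real q ^ i) ^ k) + (if even s then - ((- c) ^ k) else c ^ k) * real b"
      using count[of k] k by (simp only: geometric ck b_def sgn)
    moreover have "fps_nth (of_nat b * log_series a) k = real b * a ^ k / real k" for a
      using k by (simp add: log_series_def fps_mult_left_const_nth flip: fps_of_nat)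
    moreover have "fps_nth (\<Sum>i<s. log_series (real q ^ i)) k = (\<Sum>i<s. (real q ^ i) ^ k) / real k"
      using k by (simp add: fps_sum_nth log_series_def sum_divide_distrib)
    ultimately show ?thesis by (simp add: add_divide_distrib diff_divide_distrib mult.commute)
  qed
  have "zeta_fps (\<lambda>k. fermat_count (F k) d s) =
      (if even s then
         (1 + fps_const c * fps_X) ^ b * inverse (\<Prod>i<s. 1 - fps_const (real q ^ i) * fps_X)
       else
         inverse ((1 - fps_const c * fps_X) ^ b * (\<Prod>i<s. 1 - fps_const (real q ^ i) * fps_X)))"
  proof (cases "even s")
    case True
    have "zeta_fps (\<lambda>k. fermat_count (F k) d s) =
        (1 - fps_const (- c) * fps_X) ^ b * inverse (\<Prod>i<s. 1 - fps_const (real q ^ i) * fps_X)"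
    proof (rule zeta_fps_eq)
      show "log_deriv (- (of_nat b * log_series (- c)) + - (\<Sum>i<s. - log_series (real q ^ i)))
          ((1 - fps_const (- c) * fps_X) ^ b * inverse (\<Prod>i<s. 1 - fps_const (real q ^ i) * fps_X))"
        by (intro log_deriv_add log_deriv_inverse log_deriv_linear_power sum)
    qed (use True in \<open>auto simp: coeff sum_negf log_series_def fps_sum_nth\<close>)
    then show ?thesis using True by (simp flip: fps_const_neg)
  next
    case False
    have "zeta_fps (\<lambda>k. fermat_count (F k) d s) =
        inverse ((1 - fps_const c * fps_X) ^ b * (\<Prod>i<s. 1 - fps_const (real q ^ i) * fps_X))"
    proof (rule zeta_fps_eq)
      show "log_deriv (- (- (of_nat b * log_series c) + (\<Sum>i<s. - log_series (real q ^ i))))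
          (inverse ((1 - fps_const c * fps_X) ^ b * (\<Prod>i<s. 1 - fps_const (real q ^ i) * fps_X)))"
        by (intro log_deriv_add log_deriv_inverse log_deriv_linear_power sum)
    qed (use False in \<open>auto simp: coeff sum_negf log_series_def fps_sum_nth\<close>)
    then show ?thesis using False by simp
  qed
  then show ?thesis using count unfolding c_def b_def by blast
qed

end
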